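(* For every $\varepsilon>0$ there exist $\delta>0$ and a constant $C_\varepsilon>0$ such that the following holds for every prime $p$. Let $I\subset\mathbb{F}_p$ be an interval of length $p^{1-\delta}$, and let $H\subset\mathbb{F}_p$ be a multiplicative Hilbert cube of dimension $d$ with $H\cap I=\emptyset$. Then $d\le C_\varepsilon p^{\varepsilon}$.
   Context: Let $p$ be a prime. An interval in $\mathbb{F}_p$ of length $L$ is a set of consecutive residues $\{b, b+1,\dots,b+L-1\}$ (mod $p$) for some $b\in\mathbb{F}_p$. For a positive integer $d$, a multiplicative Hilbert cube of dimension $d$ is a set of the form $\mathcal{H}^\times(a_0;a_1,\dots,a_d)=\{a_0a_1^{n_1}\cdots a_d^{n_d} : n_1,\dots,n_d\in\{0,1\}\}$, where $a_0,a_1,\dots,a_d\in\mathbb{F}_p^\times$ and $a_1,\dots,a_d$ are pairwise distinct. *)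

theory Defs
  imports Complex_Main "HOL-Number_Theory.Residues"
begin

abbreviation Fp :: "nat \<Rightarrow> int ring" where
  "Fp p \<equiv> residue_ring (int p)"

text \<open>\<open>add_pow R j \<one>\<^bsub>R\<^esub>\<close> is the image of the natural number \<open>j\<close> in \<open>R\<close>.\<close>

definition is_interval :: "('a, 'b) ring_scheme \<Rightarrow> nat \<Rightarrow> 'a set \<Rightarrow> bool" where
  "is_interval R L I \<longleftrightarrow>
     (\<exists>b \<in> carrier R. I = {b \<oplus>\<^bsub>R\<^esub> add_pow R j \<one>\<^bsub>R\<^esub> | j :: nat. j < L})"

definition mult_hilbert_cube ::
    "('a, 'b) ring_scheme \<Rightarrow> nat \<Rightarrow> 'a \<Rightarrow> (nat \<Rightarrow> 'a) \<Rightarrow> 'a set" where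
  "mult_hilbert_cube R d a0 a =
     {a0 \<otimes>\<^bsub>R\<^esub> (\<Otimes>\<^bsub>R\<^esub> i \<in> {1..d}. a i [^]\<^bsub>R\<^esub> n i) | n :: nat \<Rightarrow> nat.
        \<forall>i \<in> {1..d}. n i \<in> {0, 1}}"

definition is_mult_hilbert_cube :: "('a, 'b) ring_scheme \<Rightarrow> nat \<Rightarrow> 'a set \<Rightarrow> bool" where
  "is_mult_hilbert_cube R d H \<longleftrightarrow>
     d \<ge> 1 \<and>
     (\<exists>a0 a. a0 \<in> Units R \<and> (\<forall>i \<in> {1..d}. a i \<in> Units R) \<and> inj_on a {1..d} \<and>
        H = mult_hilbert_cube R d a0 a)"

text \<open>The number of elements of an interval of length \<open>p powr (1 - \<delta>)\<close>. Rounding down is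
  the strongest reading: any longer interval avoiding \<open>H\<close> contains one of this length,
  which also avoids \<open>H\<close>.\<close>

definition interval_length :: "nat \<Rightarrow> real \<Rightarrow> nat" where
  "interval_length p \<delta> = nat \<lfloor>real p powr (1 - \<delta>)\<rfloor>"

end

theory Submission
  imports Defs
begin

text \<open>
  The method is that of Bourgain, Glibichuk and Konyagin. If the cube misses \<open>I\<close>, then the product
  set \<open>A\<^sub>0 A\<^sub>1 \<dots> A\<^sub>k\<close> of disjoint blocks of generators has a Fourier coefficient of size at least
  \<open>1 / K\<close> with \<open>K\<close> a tiny power of \<open>p\<close>. So the spectrum of \<open>A\<^sub>1 \<dots> A\<^sub>k\<close> contains many multiples of
  one frequency, and it suffices that removing a block from \<open>A\<^sub>i \<dots> A\<^sub>k\<close> enlarges the spectrum by a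
  fixed power of \<open>p\<close>, since Parseval bounds the spectrum of \<open>A\<^sub>k\<close>.

  If the spectrum \<open>B\<close> does not grow, positive definiteness gives, for many \<open>a \<in> A\<^sub>i\<close> and a fixed \<open>y\<close>,
  many pairs \<open>(b, c) \<in> B \<times> B\<close> with \<open>a b - y c\<close> in a set of size about \<open>|B|\<close>. The
  Balog--Szemeredi--Gowers lemma and Ruzsa's triangle inequality turn this into a large
  \<open>P \<subseteq> B\<close> with \<open>|P - x P| \<le> L |P|\<close> for a large set of \<open>x\<close>. The \<open>x\<close> with this property are closed
  under the field operations up to polynomial losses in \<open>L\<close>, hence boundedly many operations reach
  all residues, which contradicts the average of the additive energy of \<open>P\<close> and \<open>x P\<close> over \<open>x\<close>.
\<close>

section \<open>Sumsets modulo a prime\<close>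

text \<open>For small \<epsilon> the blocks have about p^(\<epsilon>/2) elements, too few for
  Parseval alone to bound a bilinear sum. This is why the number of blocks depends on \<epsilon> and
  why each removal must gain a fixed power L = p^lam. The price of the field operations fixes lam: j
  rounds, with 2^j > 4/\<epsilon>, raise the losses to the exponent 438^j, and the total loss has to
  stay at p^(\<epsilon>/8). About 1/lam blocks then suffice. Removing a block turns the level 1/K
  into 1/(4 K^2), so over k blocks K is essentially raised to the power 2^k; hence \<delta> has to
  be as small as lam / 2^k up to a constant. A generator enters a cube element at most once, which
  forces the blocks to be disjoint; this is harmless, since boundedly many blocks of size
  p^(\<epsilon>/2) fit into p^\<epsilon> generators. The interval is detected through the
  convolution of an interval of half the length with itself, whose Fourier coefficients Parseval
  sums without a logarithm.\<close>

definition sumset :: "int set \<Rightarrow> int set \<Rightarrow> int set" where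
  "sumset A B = (\<lambda>(a, b). a + b) ` (A \<times> B)"

definition diffset :: "int set \<Rightarrow> int set \<Rightarrow> int set" where
  "diffset A B = (\<lambda>(a, b). a - b) ` (A \<times> B)"

definition dilate :: "int \<Rightarrow> int set \<Rightarrow> int set" where
  "dilate x A = (\<lambda>a. x * a) ` A"

lemma sumsetI: "a \<in> A \<Longrightarrow> b \<in> B \<Longrightarrow> a + b \<in> sumset A B"
  by (auto simp: sumset_def)

lemma diffsetI: "a \<in> A \<Longrightarrow> b \<in> B \<Longrightarrow> a - b \<in> diffset A B"
  by (auto simp: diffset_def)

lemma dilate_1 [simp]: "dilate 1 A = A"
  by (simp add: dilate_def)

lemma dilate_0: "A \<noteq> {} \<Longrightarrow> dilate 0 A = {0}"
  by (auto simp: dilate_def)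

lemma sumset_mono: "A \<subseteq> A' \<Longrightarrow> B \<subseteq> B' \<Longrightarrow> sumset A B \<subseteq> sumset A' B'"
  by (auto simp: sumset_def)

lemma diffset_mono: "A \<subseteq> A' \<Longrightarrow> B \<subseteq> B' \<Longrightarrow> diffset A B \<subseteq> diffset A' B'"
  by (auto simp: diffset_def)

lemma dilate_mono: "A \<subseteq> A' \<Longrightarrow> dilate x A \<subseteq> dilate x A'"
  by (auto simp: dilate_def)

lemma dilate_diffset: "dilate x (diffset A B) = diffset (dilate x A) (dilate x B)"
  unfolding dilate_def diffset_def image_image
  by (force simp: algebra_simps image_iff)

lemma dilate_dilate: "dilate x (dilate y A) = dilate (x * y) A"
  by (simp add: dilate_def image_image mult.assoc)

lemma diffset_dilate_minus: "diffset A (dilate (- x) B) = sumset A (dilate x B)"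
proof -
  have "dilate (- x) B = uminus ` dilate x B" by (simp add: dilate_def image_image)
  moreover have "diffset A (uminus ` C) = sumset A C" for C
  proof (intro equalityI subsetI)
    fix u assume "u \<in> sumset A C"
    then obtain a c where "a \<in> A" "c \<in> C" "u = a - (- c)" by (auto simp: sumset_def)
    thus "u \<in> diffset A (uminus ` C)" using diffsetI[of a A "- c" "uminus ` C"] by simp
  next
    fix u assume "u \<in> diffset A (uminus ` C)"
    then obtain a c where "a \<in> A" "c \<in> C" "u = a + c" by (auto simp: diffset_def)
    thus "u \<in> sumset A C" using sumsetI by simp
  qed
  ultimately show ?thesis by simp
qed

lemma sumset_commute: "sumset A B = sumset B A"
  unfolding sumset_def by (subst product_swap[symmetric]) (simp add: image_image case_prod_beta add.commute)

lemma sumset_assoc: "sumset (sumset A B) C = sumset A (sumset B C)"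
proof (intro equalityI subsetI)
  fix u assume "u \<in> sumset (sumset A B) C"
  then obtain a b c where "a \<in> A" "b \<in> B" "c \<in> C" "u = a + (b + c)" by (auto simp: sumset_def)
  thus "u \<in> sumset A (sumset B C)" using sumsetI by simp
next
  fix u assume "u \<in> sumset A (sumset B C)"
  then obtain a b c where "a \<in> A" "b \<in> B" "c \<in> C" "u = (a + b) + c" by (auto simp: sumset_def)
  thus "u \<in> sumset (sumset A B) C" using sumsetI by simp
qed

lemma dilate_sumset: "dilate x (sumset A B) = sumset (dilate x A) (dilate x B)"
  unfolding dilate_def sumset_def image_image
  by (force simp: algebra_simps image_iff)

locale prime_modulus =
  fixes p :: int
  assumes prime: "prime p"
begin

text \<open>Sets stay in the integers, so that sums and dilates obey plain ring identities;
  reduction modulo \<open>p\<close> happens only in the count, which is finite for every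
  set.\<close>

definition N :: "int set \<Rightarrow> nat" where
  "N A = card ((\<lambda>x. x mod p) ` A)"

lemma p_gt_1: "p > 1" and p_pos: "p > 0"
  using prime_gt_1_int[OF prime] by auto

lemma residues_subset: "(\<lambda>x. x mod p) ` A \<subseteq> {0..<p}"
  using p_pos by auto

lemma finite_residues [simp]: "finite ((\<lambda>x. x mod p) ` A)"
  by (rule finite_subset[OF residues_subset]) simp

lemma N_empty [simp]: "N {} = 0"
  by (simp add: N_def)

lemma N_pos: "A \<noteq> {} \<Longrightarrow> N A > 0"
  by (simp add: N_def card_gt_0_iff)

lemma N_mono_residues: "(\<lambda>x. x mod p) ` A \<subseteq> (\<lambda>x. x mod p) ` B \<Longrightarrow> N A \<le> N B"
  unfolding N_def by (rule card_mono) auto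

lemma N_mono: "A \<subseteq> B \<Longrightarrow> N A \<le> N B"
  by (rule N_mono_residues) auto

lemma N_Un_le: "N (A \<union> B) \<le> N A + N B"
  unfolding N_def image_Un by (rule card_Un_le)

lemma mod_eq_self: "A \<subseteq> {0..<p} \<Longrightarrow> (\<lambda>x. x mod p) ` A = A"
  by (force simp: image_iff)

lemma N_eq_card: "A \<subseteq> {0..<p} \<Longrightarrow> N A = card A"
  unfolding N_def by (simp add: mod_eq_self)

lemma N_translate: "N ((\<lambda>x. x + c) ` A) = N A"
proof -
  have "(\<lambda>x. x mod p) ` (\<lambda>x. x + c) ` A = (\<lambda>y. (y + c) mod p) ` (\<lambda>x. x mod p) ` A"
    by (simp add: image_image mod_simps)
  moreover have "inj_on (\<lambda>y. (y + c) mod p) ((\<lambda>x. x mod p) ` A)"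
  proof (rule inj_on_subset[OF _ residues_subset], rule inj_onI)
    fix x y assume "x \<in> {0..<p}" "y \<in> {0..<p}" "(x + c) mod p = (y + c) mod p"
    hence "p dvd x - y" by (simp add: mod_eq_dvd_iff)
    thus "x = y" using \<open>x \<in> _\<close> \<open>y \<in> _\<close>
      by (metis atLeastLessThan_iff mod_eq_dvd_iff mod_pos_pos_trivial)
  qed
  ultimately show ?thesis by (simp add: N_def card_image)
qed

lemma mult_mod_cancel:
  assumes "\<not> p dvd c" "(c * x) mod p = (c * y) mod p"
  shows "x mod p = y mod p"
proof -
  have "p dvd c * (x - y)" using assms(2) by (simp add: mod_eq_dvd_iff right_diff_distrib)
  thus ?thesis using assms(1) prime by (simp add: mod_eq_dvd_iff prime_dvd_mult_iff)
qed

lemma N_dilate: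
  assumes "\<not> p dvd c"
  shows "N (dilate c A) = N A"
proof -
  have "(\<lambda>x. x mod p) ` dilate c A = (\<lambda>y. (c * y) mod p) ` (\<lambda>x. x mod p) ` A"
    by (simp add: image_image mod_simps dilate_def)
  moreover have inj: "inj_on (\<lambda>y. (c * y) mod p) ((\<lambda>x. x mod p) ` A)"
  proof (rule inj_onI, clarify)
    fix x y :: int
    assume "c * (x mod p) mod p = c * (y mod p) mod p"
    thus "x mod p = y mod p" using mult_mod_cancel[OF assms, of "x mod p" "y mod p"] by simp
  qed
  ultimately show ?thesis unfolding N_def using card_image[OF inj] by metis
qed

lemma N_diffset_commute: "N (diffset A B) = N (diffset B A)"
proof -
  have "diffset B A = dilate (-1) (diffset A B)"
    unfolding dilate_def diffset_def image_image by (force simp: image_iff)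
  moreover have "\<not> p dvd -1" using p_gt_1 by (simp add: zdvd1_eq)
  ultimately show ?thesis by (simp add: N_dilate)
qed

text \<open>Fix a representative b for each residue of B and one expression a - c for each residue z
  of A - C. The pair (a - b, b - c) determines its sum z, hence a and c, hence b.\<close>

lemma ruzsa_triangle: "N B * N (diffset A C) \<le> N (diffset A B) * N (diffset B C)"
proof -
  let ?m = "\<lambda>x::int. x mod p"
  have "\<forall>y\<in>?m ` B. \<exists>b\<in>B. b mod p = y" by auto
  then obtain f where f: "\<And>y. y \<in> ?m ` B \<Longrightarrow> f y \<in> B \<and> f y mod p = y" by metis
  have "\<forall>z\<in>?m ` diffset A C. \<exists>a c. a \<in> A \<and> c \<in> C \<and> (a - c) mod p = z"
    by (auto simp: diffset_def)
  then obtain g h where gh: "\<And>z. z \<in> ?m ` diffset A C \<Longrightarrow> g z \<in> A \<and> h z \<in> C \<and> (g z - h z) mod p = z"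
    by metis
  let ?F = "\<lambda>(y, z). ((g z - f y) mod p, (f y - h z) mod p)"
  have "inj_on ?F (?m ` B \<times> ?m ` diffset A C)"
  proof (rule inj_onI, clarify del: imageE)
    fix y z y' z'
    assume *: "y \<in> ?m ` B" "z \<in> ?m ` diffset A C" "y' \<in> ?m ` B" "z' \<in> ?m ` diffset A C"
      and e: "(g z - f y) mod p = (g z' - f y') mod p" "(f y - h z) mod p = (f y' - h z') mod p"
    have "((g z - f y) + (f y - h z)) mod p = ((g z' - f y') + (f y' - h z')) mod p"
      using e by (metis mod_add_eq)
    hence z: "z = z'" using gh[OF *(2)] gh[OF *(4)] by simp
    have "f y mod p = f y' mod p"
      using e(1) unfolding z mod_eq_dvd_iff by (simp add: dvd_diff_commute)
    thus "y = y' \<and> z = z'" using z f[OF *(1)] f[OF *(3)] by simp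
  qed
  moreover have "?F ` (?m ` B \<times> ?m ` diffset A C) \<subseteq> ?m ` diffset A B \<times> ?m ` diffset B C"
    using f gh by (fastforce intro!: imageI diffsetI)
  ultimately have "card (?m ` B \<times> ?m ` diffset A C) \<le> card (?m ` diffset A B \<times> ?m ` diffset B C)"
    by (intro card_inj_on_le) auto
  thus ?thesis by (simp add: N_def card_cartesian_product)
qed

text \<open>\<open>X\<close> minimises |Y + B| / |Y| over the nonempty subsets Y of A; comparison
  with A gives the first bound. The second follows by induction on C: a new element c adds to X + B
  + C only what is not already covered, and minimality, applied to the covered part of X, balances
  this against the growth of X + C.\<close>

lemma petridis:
  assumes "finite A" "A \<noteq> {}"
  obtains X where "X \<subseteq> A" "X \<noteq> {}" "N (sumset X B) * N A \<le> N (sumset A B) * N X"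
    "\<And>C. finite C \<Longrightarrow> N (sumset (sumset X B) C) * N X \<le> N (sumset X B) * N (sumset X C)"
proof -
  let ?m = "\<lambda>x::int. x mod p"
  let ?r = "\<lambda>Y. real (N (sumset Y B)) / real (N Y)"
  let ?S = "Pow A - {{}}"
  have S: "finite ?S" "?S \<noteq> {}" using assms by auto
  obtain X where X: "X \<in> ?S" and Xmin: "\<And>Y. Y \<in> ?S \<Longrightarrow> ?r X \<le> ?r Y"
    using ex_min_if_finite[of "?r ` ?S"] S by (auto simp: not_less)
  have min: "N (sumset X B) * N Y \<le> N (sumset Y B) * N X" if "Y \<subseteq> A" for Y
  proof (cases "Y = {}")
    case False
    hence "N X > 0" "N Y > 0" using X N_pos by auto
    moreover have "?r X \<le> ?r Y" using Xmin that False by auto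
    ultimately have "real (N (sumset X B)) * N Y \<le> real (N (sumset Y B)) * N X"
      by (simp add: field_simps)
    thus ?thesis by (metis of_nat_le_iff of_nat_mult)
  qed simp
  have "N (sumset (sumset X B) C) * N X \<le> N (sumset X B) * N (sumset X C)" if "finite C" for C
    using that
  proof (induction C)
    case empty
    then show ?case by (simp add: sumset_def)
  next
    case (insert c C)
    \<comment> \<open>The elements x for which the whole translate x + B + c already lies in X + B +
      C.\<close>
    define Y where "Y = {x \<in> X. \<forall>b\<in>B. (x + b + c) mod p \<in> ?m ` sumset (sumset X B) C}"
    have YA: "Y \<subseteq> A" and YX: "Y \<subseteq> X" using X by (auto simp: Y_def)
    let ?c = "\<lambda>Z. (\<lambda>x. x + c) ` Z"
    have "?m ` sumset (sumset X B) (insert c C) \<subseteq>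
        ?m ` sumset (sumset X B) C \<union> (?m ` ?c (sumset X B) - ?m ` ?c (sumset Y B))"
    proof (rule image_subsetI)
      fix u assume "u \<in> sumset (sumset X B) (insert c C)"
      then obtain v d where u: "u = v + d" "v \<in> sumset X B" "d \<in> insert c C"
        by (auto simp: sumset_def)
      have Yc: "?m ` ?c (sumset Y B) \<subseteq> ?m ` sumset (sumset X B) C"
        by (auto simp: sumset_def Y_def image_image)
      show "u mod p \<in> ?m ` sumset (sumset X B) C \<union> (?m ` ?c (sumset X B) - ?m ` ?c (sumset Y B))"
      proof (cases "d = c")
        case True
        hence "u mod p \<in> ?m ` ?c (sumset X B)" using u by blast
        thus ?thesis using Yc by blast
      next
        case False
        hence "u \<in> sumset (sumset X B) C" using u by (auto intro: sumsetI)
        thus ?thesis by blast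
      qed
    qed
    hence "N (sumset (sumset X B) (insert c C)) \<le>
        card (?m ` sumset (sumset X B) C \<union> (?m ` ?c (sumset X B) - ?m ` ?c (sumset Y B)))"
      unfolding N_def by (intro card_mono) auto
    also have "\<dots> \<le> N (sumset (sumset X B) C) + card (?m ` ?c (sumset X B) - ?m ` ?c (sumset Y B))"
      unfolding N_def by (rule card_Un_le)
    also have "card (?m ` ?c (sumset X B) - ?m ` ?c (sumset Y B))
        = N (?c (sumset X B)) - N (?c (sumset Y B))"
      unfolding N_def by (rule card_Diff_subset) (use YX in \<open>auto simp: sumset_def\<close>)
    finally have 1: "N (sumset (sumset X B) (insert c C)) + N (sumset Y B)
        \<le> N (sumset (sumset X B) C) + N (sumset X B)"
      using N_mono[OF sumset_mono[OF YX subset_refl, of B]] unfolding N_translate by linarith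
    \<comment> \<open>The part of X + c outside Y + c is disjoint from X + C: if x + c = y + d with
      d in C, then x + b + c = y + b + d for all b in B, so x lies in Y.\<close>
    have "N (sumset X C) + (N (?c X) - N (?c Y)) =
        card (?m ` sumset X C \<union> (?m ` ?c X - ?m ` ?c Y))"
    proof -
      have "?m ` sumset X C \<inter> (?m ` ?c X - ?m ` ?c Y) = {}"
      proof (rule ccontr)
        assume "\<not> ?thesis"
        then obtain x y d where xy: "x \<in> X" "y \<in> X" "d \<in> C" "(y + d) mod p = (x + c) mod p"
          "(x + c) mod p \<notin> ?m ` ?c Y"
          by (auto simp: sumset_def image_image)
        have "x \<in> Y" unfolding Y_def
        proof (safe, fact)
          fix b assume "b \<in> B"
          have "(x + b + c) mod p = ((x + c) + b) mod p" by (simp add: algebra_simps)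
          also have "\<dots> = ((y + d) + b) mod p" using xy(4) by (metis mod_add_left_eq)
          also have "\<dots> = (y + b + d) mod p" by (simp add: algebra_simps)
          finally show "(x + b + c) mod p \<in> ?m ` sumset (sumset X B) C"
            using xy \<open>b \<in> B\<close> by (auto intro!: image_eqI sumsetI)
        qed
        thus False using xy(5) by auto
      qed
      moreover have "card (?m ` ?c X - ?m ` ?c Y) = N (?c X) - N (?c Y)"
        unfolding N_def by (rule card_Diff_subset) (use YX in auto)
      ultimately show ?thesis unfolding N_def by (subst card_Un_disjoint) auto
    qed
    also have "\<dots> \<le> N (sumset X (insert c C))"
      unfolding N_def by (intro card_mono) (auto simp: sumset_def)
    finally have 2: "N (sumset X C) + N X \<le> N (sumset X (insert c C)) + N Y"
      using N_mono[OF YX] unfolding N_translate by simp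
    have "N (sumset (sumset X B) (insert c C)) * N X + N (sumset Y B) * N X
        \<le> N (sumset (sumset X B) C) * N X + N (sumset X B) * N X"
      using mult_le_mono1[OF 1, of "N X"] by (simp add: algebra_simps)
    also have "\<dots> \<le> N (sumset X B) * N (sumset X C) + N (sumset X B) * N X"
      using insert.IH by simp
    also have "\<dots> \<le> N (sumset X B) * N (sumset X (insert c C)) + N (sumset X B) * N Y"
      using mult_le_mono2[OF 2, of "N (sumset X B)"] by (simp add: algebra_simps)
    finally show ?case using min[OF YA] by linarith
  qed
  thus ?thesis using that[of X] X min[of A] by auto
qed

end

section \<open>Dilations with small difference set\<close>

context prime_modulus
begin

definition close :: "int set \<Rightarrow> real \<Rightarrow> int \<Rightarrow> bool" where
  "close R K x \<longleftrightarrow> real (N (diffset R (dilate x R))) \<le> K * real (N R)"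

lemma close_mono: "close R K x \<Longrightarrow> K \<le> K' \<Longrightarrow> close R K' x"
  unfolding close_def by (meson mult_right_mono of_nat_0_le_iff order_trans)

lemma N_diffset_dilate_cong:
  assumes "x mod p = y mod p"
  shows "N (diffset A (dilate x B)) = N (diffset A (dilate y B))"
proof -
  have "(\<lambda>u. u mod p) ` diffset A (dilate x B) = (\<lambda>u. u mod p) ` diffset A (dilate y B)"
    if "x mod p = y mod p" for x y
  proof -
    have "(a - x * b) mod p = (a - y * b) mod p" for a b
      using that by (intro mod_diff_cong mod_mult_cong) auto
    thus ?thesis
      unfolding diffset_def dilate_def by (force simp: image_iff)
  qed
  thus ?thesis using assms unfolding N_def by metis
qed

lemma close_cong: "x mod p = y mod p \<Longrightarrow> close R K x \<longleftrightarrow> close R K y"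
  unfolding close_def by (subst N_diffset_dilate_cong) auto

lemma close_0:
  assumes "p dvd x" "1 \<le> K"
  shows "close R K x"
proof (cases "R = {}")
  case False
  have "N (diffset R (dilate x R)) = N (diffset R (dilate 0 R))"
    using assms by (intro N_diffset_dilate_cong) auto
  also have "diffset R (dilate 0 R) = R" using False by (force simp: dilate_0 diffset_def)
  finally show ?thesis unfolding close_def using assms
    by (metis mult_1 mult_right_mono of_nat_0_le_iff)
qed (simp add: close_def diffset_def)

text \<open>The triangle inequality with pivot xR, since xR - xyR is the dilate by x of R - yR. If p
  divides x the pivot collapses to a point, and the product is close for trivial reasons.\<close>

lemma close_mult:
  assumes "close R K x" "close R K' y" "1 \<le> K" "1 \<le> K'" "R \<noteq> {}"
  shows "close R (K * K') (x * y)"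
proof (cases "p dvd x")
  case True
  thus ?thesis using assms mult_mono[of 1 K 1 K'] by (intro close_0) auto
next
  case False
  have "N (dilate x R) * N (diffset R (dilate (x * y) R))
      \<le> N (diffset R (dilate x R)) * N (diffset (dilate x R) (dilate (x * y) R))"
    by (rule ruzsa_triangle)
  also have "diffset (dilate x R) (dilate (x * y) R) = dilate x (diffset R (dilate y R))"
    by (simp add: dilate_diffset dilate_dilate)
  finally have "real (N R * N (diffset R (dilate (x * y) R)))
      \<le> real (N (diffset R (dilate x R)) * N (diffset R (dilate y R)))"
    using False by (simp add: N_dilate del: of_nat_mult)
  also have "\<dots> \<le> (K * N R) * (K' * N R)"
    using assms unfolding close_def of_nat_mult by (intro mult_mono) auto
  finally have "real (N R) * real (N (diffset R (dilate (x * y) R))) \<le> N R * (K * K' * N R)"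
    by (simp add: algebra_simps)
  thus ?thesis using N_pos[OF \<open>R \<noteq> {}\<close>] unfolding close_def by simp
qed

text \<open>Dilation by x turns R - yR into xR - R.\<close>

lemma close_inverse:
  assumes "close R K x" "(x * y) mod p = 1"
  shows "close R K y"
proof -
  have "\<not> p dvd x" using assms(2) by auto
  hence "N (diffset R (dilate y R)) = N (diffset (dilate x R) (dilate (x * y) R))"
    by (metis N_dilate dilate_diffset dilate_dilate)
  also have "\<dots> = N (diffset (dilate x R) (dilate 1 R))"
    using assms(2) p_gt_1 by (intro N_diffset_dilate_cong) auto
  finally show ?thesis using assms(1) by (simp add: close_def N_diffset_commute[of R])
qed

text \<open>\<open>B\<close> is the union of -R, -xR and -yR, so one application of
  \<open>petridis\<close> serves all three dilates at once: |X + B| \<le> 3K |X|, then |X + B + B|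
  \<le> 9K^2 |X|. The pivot -X in the triangle inequality gives |B - (B + B)| \<le> 27K^3 |X|, and
  up to sign this set, or its negative, contains R - (x + y)R and R - (x - y)R.\<close>

lemma close_add_diff:
  assumes "finite R" "R \<noteq> {}" "close R K 1" "close R K x" "close R K y"
  shows "close R (27 * K ^ 3) (x + y)" and "close R (27 * K ^ 3) (x - y)"
proof -
  define B where "B = dilate (-1) R \<union> (dilate (-x) R \<union> dilate (-y) R)"
  have finB: "finite B" unfolding B_def dilate_def using assms by simp
  have eq: "sumset R (dilate (-z) R) = diffset R (dilate z R)" for z
    using diffset_dilate_minus[of R "-z" R] by simp
  have Un: "sumset R (U \<union> V) = sumset R U \<union> sumset R V" for U V
    unfolding sumset_def by auto
  have "real (N (sumset R B)) \<le> N (diffset R (dilate 1 R)) + (N (diffset R (dilate x R))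
      + N (diffset R (dilate y R)))"
    unfolding B_def Un eq of_nat_add[symmetric] of_nat_le_iff
    by (rule order_trans[OF N_Un_le add_left_mono[OF N_Un_le]])
  also have "\<dots> \<le> 3 * K * N R" using assms unfolding close_def by simp
  finally have RB: "real (N (sumset R B)) \<le> 3 * K * N R" .
  obtain X where X: "X \<subseteq> R" "X \<noteq> {}" "N (sumset X B) * N R \<le> N (sumset R B) * N X"
    "\<And>C. finite C \<Longrightarrow> N (sumset (sumset X B) C) * N X \<le> N (sumset X B) * N (sumset X C)"
    using petridis[OF assms(1,2)] by blast
  have pos: "real (N X) > 0" "real (N R) > 0" using N_pos X assms by auto
  have "real (N (sumset X B)) * N R \<le> real (N (sumset R B)) * N X"
    using X(3) by (metis of_nat_mult of_nat_le_iff)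
  also have "\<dots> \<le> (3 * K * N R) * N X" using RB by (intro mult_right_mono) auto
  finally have 1: "real (N (sumset X B)) \<le> 3 * K * N X" using pos by simp
  have "real (N (sumset (sumset X B) B)) * N X \<le> real (N (sumset X B)) * N (sumset X B)"
    using X(4)[OF finB] by (metis of_nat_mult of_nat_le_iff)
  also have "\<dots> \<le> (3 * K * N X) * (3 * K * N X)"
    using 1 order_trans[OF of_nat_0_le_iff 1] by (intro mult_mono) auto
  also have "\<dots> = (9 * K\<^sup>2 * N X) * N X" by (simp add: power2_eq_square)
  finally have 2: "real (N (sumset (sumset X B) B)) \<le> 9 * K\<^sup>2 * N X" using pos by simp
  have m1: "\<not> p dvd -1" using p_gt_1 by (simp add: zdvd1_eq)
  have "N (dilate (-1) X) * N (diffset B (sumset B B)) \<le>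
      N (diffset B (dilate (-1) X)) * N (diffset (dilate (-1) X) (sumset B B))"
    by (rule ruzsa_triangle)
  also have "diffset B (dilate (-1) X) = sumset X B"
    by (simp add: diffset_dilate_minus sumset_commute)
  also have "diffset (dilate (-1) X) (sumset B B) = dilate (-1) (sumset (sumset X B) B)"
    using diffset_dilate_minus[of "dilate (-1) X" 1 "dilate (-1) (sumset B B)"]
    by (simp add: dilate_dilate sumset_assoc dilate_sumset)
  finally have "N X * N (diffset B (sumset B B)) \<le> N (sumset X B) * N (sumset (sumset X B) B)"
    by (simp add: N_dilate[OF m1])
  hence "real (N X) * N (diffset B (sumset B B)) \<le> N (sumset X B) * real (N (sumset (sumset X B) B))"
    by (metis of_nat_mult of_nat_le_iff)
  also have "\<dots> \<le> (3 * K * N X) * (9 * K\<^sup>2 * N X)"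
    using 1 2 order_trans[OF of_nat_0_le_iff 1] by (intro mult_mono) auto
  also have "\<dots> = N X * (27 * K ^ 3 * N X)" by (simp add: power2_eq_square power3_eq_cube)
  finally have 3: "real (N (diffset B (sumset B B))) \<le> 27 * K ^ 3 * N X" using pos by simp
  have "0 \<le> K" using 1 pos by (metis (no_types, opaque_lifting) mult_neg_pos not_le of_nat_0_le_iff
        order_trans zero_less_numeral mult_pos_neg)
  hence "27 * K ^ 3 * N X \<le> 27 * K ^ 3 * N R"
    using N_mono[OF X(1)] by (intro mult_left_mono) auto
  with 3 have 4: "real (N (diffset B (sumset B B))) \<le> 27 * K ^ 3 * N R" by simp
  have Bs: "- r \<in> B" "- (x * r) \<in> B" "- (y * r) \<in> B" if "r \<in> R" for r
    using that unfolding B_def dilate_def by auto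
  have "dilate (-1) (diffset R (dilate (x + y) R)) \<subseteq> diffset B (sumset B B)"
  proof
    fix u assume "u \<in> dilate (-1) (diffset R (dilate (x + y) R))"
    then obtain r s where "r \<in> R" "s \<in> R" "u = - r - (-(x * s) + -(y * s))"
      by (auto simp: dilate_def diffset_def algebra_simps)
    thus "u \<in> diffset B (sumset B B)" using diffsetI[OF Bs(1) sumsetI[OF Bs(2,3)]] by simp
  qed
  from N_mono[OF this] 4 show "close R (27 * K ^ 3) (x + y)"
    unfolding close_def N_dilate[OF m1] by linarith
  have "dilate (-1) (diffset R (dilate (x - y) R)) \<subseteq> diffset (sumset B B) B"
  proof
    fix u assume "u \<in> dilate (-1) (diffset R (dilate (x - y) R))"
    then obtain r s where "r \<in> R" "s \<in> R" "u = (- r + -(y * s)) - (-(x * s))"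
      by (auto simp: dilate_def diffset_def algebra_simps)
    thus "u \<in> diffset (sumset B B) B" using diffsetI[OF sumsetI[OF Bs(1,3)] Bs(2)] by simp
  qed
  from N_mono[OF this] 4 show "close R (27 * K ^ 3) (x - y)"
    unfolding close_def N_dilate[OF m1] N_diffset_commute[of "sumset B B"] by linarith
qed

lemma inverse_mod_ex:
  assumes "\<not> p dvd x"
  obtains y where "(x * y) mod p = 1"
proof -
  have "coprime x p" using prime_imp_coprime[OF prime assms] by (simp add: coprime_commute)
  then obtain y where "[x * y = 1] (mod p)" using cong_solve_coprime_int by blast
  thus ?thesis using that p_gt_1 by (simp add: cong_def)
qed

lemma dvd_diff_residues:
  assumes "x \<in> {0..<p}" "y \<in> {0..<p}" "p dvd x - y"
  shows "x = y"
  using assms by (metis atLeastLessThan_iff mod_eq_dvd_iff mod_pos_pos_trivial)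

text \<open>The quotient set (D - D) / (D - D) either is everything, or it contains some \<open>\<xi>\<close> with
  \<open>\<xi> + 1\<close> outside it; in the latter case \<open>(d, e) \<mapsto> d + (\<xi> + 1) e\<close> is injective on
  \<open>D \<times> D\<close>, which squares the number of close dilations.\<close>

lemma close_generate_step:
  assumes R: "finite R" "R \<noteq> {}" and K: "3 \<le> K" and c1: "close R K 1"
    and D: "D \<subseteq> {0..<p}" "card D \<ge> 2" "\<And>x. x \<in> D \<Longrightarrow> close R K x"
  shows "(\<forall>x. close R (K ^ 12) x) \<or>
    (\<exists>D' \<subseteq> {0..<p}. card D' = card D ^ 2 \<and> (\<forall>x\<in>D'. close R (K ^ 438) x))"
proof -
  have K1: "1 \<le> K" using K by simp
  \<comment> \<open>Since 27 \<le> L^3, the bound 27 L^3 is at most L^6; a pure power lets the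
    exponents of successive operations multiply.\<close>
  have pm: "close R (L ^ 6) (x + y) \<and> close R (L ^ 6) (x - y)"
    if "3 \<le> L" "close R L 1" "close R L x" "close R L y" for L x y
  proof -
    have "27 * L ^ 3 \<le> L ^ 3 * L ^ 3" using power_mono[OF that(1), of 3] that(1)
      by (intro mult_right_mono) auto
    hence "27 * L ^ 3 \<le> L ^ 6" by (simp flip: power_add)
    thus ?thesis using close_add_diff[OF R that(2-4)] close_mono by blast
  qed
  have up: "close R (K ^ m) x \<Longrightarrow> m \<le> n \<Longrightarrow> close R (K ^ n) x" for m n x
    using close_mono power_increasing[OF _ K1] by blast
  have K3: "3 \<le> K ^ n" if "n > 0" for n
    using K self_le_power[OF K1 that] by linarith
  define Q where "Q x \<longleftrightarrow> (\<exists>a\<in>D. \<exists>b\<in>D. \<exists>c\<in>D. \<exists>d\<in>D. c \<noteq> d \<and> p dvd x * (c - d) - (a - b))" for x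
  have nd: "\<not> p dvd c - d" if "c \<in> D" "d \<in> D" "c \<noteq> d" for c d
    using dvd_diff_residues that D(1) by blast
  have Qclose: "close R (K ^ 12) x" if "Q x" for x
  proof -
    obtain a b c d where abcd: "a \<in> D" "b \<in> D" "c \<in> D" "d \<in> D" "c \<noteq> d" "p dvd x * (c - d) - (a - b)"
      using \<open>Q x\<close> unfolding Q_def by blast
    obtain y where y: "((c - d) * y) mod p = 1"
      using inverse_mod_ex[OF nd[OF abcd(3-5)]] .
    have "close R (K ^ 6) (a - b)" "close R (K ^ 6) (c - d)" using pm D(3) abcd K c1 by blast+
    hence "close R (K ^ 6 * K ^ 6) ((a - b) * y)"
      using close_inverse[OF _ y] R K1 by (intro close_mult) (auto simp: one_le_power)
    moreover have "x mod p = ((a - b) * y) mod p"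
    proof -
      have "x mod p = (x * ((c - d) * y)) mod p" using y by (metis mod_mult_right_eq mult.right_neutral)
      also have "\<dots> = ((x * (c - d)) * y) mod p" by (simp add: mult.assoc)
      also have "\<dots> = ((a - b) * y) mod p"
        using abcd(6) by (intro mod_mult_cong) (auto simp: mod_eq_dvd_iff)
      finally show ?thesis .
    qed
    ultimately show ?thesis using close_cong[of x "(a - b) * y"] by (simp flip: power_add)
  qed
  show ?thesis
  proof (cases "\<forall>x. Q x")
    case True
    thus ?thesis using Qclose by blast
  next
    case False
    have "finite D" using D(1) finite_subset by blast
    then obtain c d where cd: "c \<in> D" "d \<in> D" "c \<noteq> d"
      using D(2) card_le_Suc0_iff_eq[of D] by force
    have Q0: "Q 0" unfolding Q_def using cd by force
    \<comment> \<open>\<open>Q\<close> depends only on the residue and holds at 0, so closure under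
      adding 1 would make it hold everywhere.\<close>
    have "\<exists>\<xi>. Q \<xi> \<and> \<not> Q (\<xi> + 1)"
    proof (rule ccontr)
      assume neg: "\<not> ?thesis"
      have Qn: "Q (int n)" for n
      proof (induction n)
        case (Suc n)
        hence "Q (int n + 1)" using neg by blast
        thus ?case by (simp add: add.commute)
      qed (use Q0 in simp)
      have "Q x" for x
      proof -
        have "Q (x mod p)" using Qn[of "nat (x mod p)"] p_pos by simp
        moreover have "p dvd x * e - f" if "p dvd (x mod p) * e - f" for e f
          using that by (metis mod_eq_dvd_iff mod_mult_left_eq)
        ultimately show ?thesis unfolding Q_def by blast
      qed
      thus False using False by blast
    qed
    then obtain \<xi> where \<xi>: "Q \<xi>" "\<not> Q (\<xi> + 1)" by blast
    let ?f = "\<lambda>(d, e). (d + (\<xi> + 1) * e) mod p"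
    have "inj_on ?f (D \<times> D)"
    proof (rule inj_onI, clarify)
      fix d e d' e' assume *: "d \<in> D" "e \<in> D" "d' \<in> D" "e' \<in> D"
        and "(d + (\<xi> + 1) * e) mod p = (d' + (\<xi> + 1) * e') mod p"
      hence dvd: "p dvd (\<xi> + 1) * (e - e') - (d' - d)"
        by (simp add: mod_eq_dvd_iff algebra_simps)
      \<comment> \<open>Otherwise \<xi> + 1 would be the quotient (d' - d) / (e - e') of differences
        from \<open>D\<close>.\<close>
      hence e: "e = e'" using * \<xi>(2) unfolding Q_def by blast
      hence "p dvd d - d'" using dvd by simp
      thus "d = d' \<and> e = e'" using e * D(1) dvd_diff_residues by blast
    qed
    hence "card (?f ` (D \<times> D)) = card D ^ 2"
      by (simp add: card_image card_cartesian_product power2_eq_square)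
    moreover have "?f ` (D \<times> D) \<subseteq> {0..<p}" using p_pos by auto
    \<comment> \<open>The exponent is 12 for \<xi>, 12 * 6 = 72 for \<xi> + 1, 73 after
      multiplication by e, and 73 * 6 = 438 after adding d.\<close>
    moreover have "close R (K ^ 438) x" if x: "x \<in> ?f ` (D \<times> D)" for x
    proof -
      obtain d e where de: "d \<in> D" "e \<in> D" "x = (d + (\<xi> + 1) * e) mod p"
        using x by auto
      have c12: "close R (K ^ 12) 1" using up[of 1 1 12] c1 by simp
      have "close R ((K ^ 12) ^ 6) (\<xi> + 1)"
        using pm[OF K3[OF zero_less_numeral] c12 Qclose[OF \<xi>(1)] c12] by blast
      hence "close R ((K ^ 12) ^ 6 * K) ((\<xi> + 1) * e)"
        using D(3)[OF de(2)] R K1 by (intro close_mult) (simp_all add: one_le_power)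
      moreover have "(K ^ 12) ^ 6 * K = K ^ 73" by (simp flip: power_mult power_Suc2)
      ultimately have 1: "close R (K ^ 73) ((\<xi> + 1) * e)" by simp
      have c73: "close R (K ^ 73) 1" "close R (K ^ 73) d"
        using up[of 1 _ 73] c1 D(3)[OF de(1)] by simp_all
      have "close R ((K ^ 73) ^ 6) (d + (\<xi> + 1) * e)"
        using pm[OF K3[OF zero_less_numeral] c73 1] by blast
      thus ?thesis unfolding de(3) by (subst close_cong[of _ "d + (\<xi> + 1) * e"]) (simp_all flip: power_mult)
    qed
    ultimately show ?thesis by blast
  qed
qed

text \<open>Every round either reaches all residues or squares the size of the set of close
  dilations and raises K to the power 438. After j squarings the set would have more than p
  residues, so the first alternative must occur on the way.\<close>

lemma close_generate:
  assumes "finite R" "R \<noteq> {}" "3 \<le> K" "close R K 1"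
    and "D \<subseteq> {0..<p}" "card D \<ge> 2" "\<And>x. x \<in> D \<Longrightarrow> close R K x"
    and "real (card D) ^ (2 ^ j) > p"
  shows "close R (K ^ (438 ^ j)) x"
  using assms(3-)
proof (induction j arbitrary: D K)
  case 0
  have "card D \<le> card {0..<p}" using 0 by (intro card_mono) auto
  thus ?case using 0 p_pos by simp
next
  case (Suc j)
  have K1: "1 \<le> K" using Suc.prems by simp
  have "(12::nat) * 1 \<le> 438 * 438 ^ j" by (intro mult_le_mono) auto
  hence e: "K ^ 12 \<le> K ^ (438 ^ Suc j)" using K1 by (intro power_increasing) auto
  from close_generate_step[OF assms(1,2) Suc.prems(1-5)] show ?case
  proof
    assume "\<forall>x. close R (K ^ 12) x"
    thus ?thesis using close_mono e by blast
  next
    assume "\<exists>D'\<subseteq>{0..<p}. card D' = card D ^ 2 \<and> (\<forall>x\<in>D'. close R (K ^ 438) x)"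
    then obtain D' where D': "D' \<subseteq> {0..<p}" "card D' = card D ^ 2" "\<forall>x\<in>D'. close R (K ^ 438) x"
      by blast
    have "card D ^ 1 \<le> card D ^ 2" using Suc.prems(4) by (intro power_increasing) auto
    hence "2 \<le> card D'" using Suc.prems(4) D'(2) by simp
    moreover have "3 \<le> K ^ 438" using Suc.prems(1) self_le_power[OF K1, of 438] by linarith
    moreover have "close R (K ^ 438) 1"
      using close_mono[OF Suc.prems(2)] self_le_power[OF K1, of 438] by simp
    moreover have "p < real (card D') ^ 2 ^ j"
      using Suc.prems(6) D'(2) by (simp flip: power_mult)
    ultimately have "close R ((K ^ 438) ^ (438 ^ j)) x" using Suc.IH D' by blast
    thus ?thesis by (simp flip: power_mult)
  qed
qed

end

section \<open>Double counting and the Balog--Szemeredi--Gowers lemma\<close>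

lemma sum_squared_le_card_mult:
  fixes f :: "'a \<Rightarrow> real"
  assumes "finite I"
  shows "(\<Sum>i\<in>I. f i)\<^sup>2 \<le> card I * (\<Sum>i\<in>I. (f i)\<^sup>2)"
proof (cases "I = {}")
  case False
  define s n where "s = (\<Sum>i\<in>I. f i)" and "n = real (card I)"
  have n: "n > 0" using False assms by (simp add: n_def card_gt_0_iff)
  have "0 \<le> (\<Sum>i\<in>I. (n * f i - s)\<^sup>2)" by (rule sum_nonneg) simp
  also have "\<dots> = (\<Sum>i\<in>I. n\<^sup>2 * (f i)\<^sup>2 - 2 * n * s * f i + s\<^sup>2)"
    by (intro sum.cong refl) (simp add: power2_diff power_mult_distrib)
  also have "\<dots> = n\<^sup>2 * (\<Sum>i\<in>I. (f i)\<^sup>2) - 2 * n * s * s + n * s\<^sup>2"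
    by (simp add: sum.distrib sum_subtractf sum_distrib_left s_def n_def)
  also have "\<dots> = n * (n * (\<Sum>i\<in>I. (f i)\<^sup>2) - s\<^sup>2)" by (simp add: power2_eq_square algebra_simps)
  finally show ?thesis using n by (simp add: zero_le_mult_iff s_def n_def)
qed simp

text \<open>Indices with value below half of the guaranteed average contribute at most half of the
  guaranteed sum, and each of the others at most c.\<close>

lemma card_popular:
  fixes f :: "'a \<Rightarrow> real"
  assumes "finite I" "\<And>i. i \<in> I \<Longrightarrow> f i \<le> c" "0 < c" "0 \<le> t" "t * c * card I \<le> (\<Sum>i\<in>I. f i)"
  shows "t / 2 * card I \<le> card {i \<in> I. t / 2 * c \<le> f i}"
proof -
  let ?G = "{i \<in> I. t / 2 * c \<le> f i}"
  have "(\<Sum>i\<in>I. f i) = (\<Sum>i\<in>I - ?G. f i) + (\<Sum>i\<in>?G. f i)"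
    using assms(1) by (intro sum.subset_diff) auto
  also have "(\<Sum>i\<in>?G. f i) \<le> card ?G * c" using assms(2) by (intro sum_bounded_above) auto
  also have "(\<Sum>i\<in>I - ?G. f i) \<le> card (I - ?G) * (t / 2 * c)" by (intro sum_bounded_above) auto
  also have "\<dots> \<le> card I * (t / 2 * c)"
    using assms by (intro mult_right_mono) (auto intro: card_mono)
  finally have "(t / 2 * card I) * c \<le> card ?G * c" using assms(5) by (simp add: algebra_simps)
  thus ?thesis using assms(3) by simp
qed

text \<open>Cauchy-Schwarz for the fibre sizes: they add up to |X|, and their squares add up to the
  number of collisions.\<close>

lemma card_squared_le_image_mult_collisions:
  assumes "finite X"
  shows "card X ^ 2 \<le> card (f ` X) * card {(u, v). u \<in> X \<and> v \<in> X \<and> f u = f v}"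
proof -
  define c where "c z = card {x \<in> X. f x = z}" for z
  have 1: "card X = (\<Sum>z\<in>f ` X. c z)"
    using sum.image_gen[OF assms, of "\<lambda>_. 1::nat" f] by (simp add: c_def)
  have "{(u, v). u \<in> X \<and> v \<in> X \<and> f u = f v} = (SIGMA u:X. {v \<in> X. f v = f u})" by auto
  hence "card {(u, v). u \<in> X \<and> v \<in> X \<and> f u = f v} = (\<Sum>u\<in>X. c (f u))"
    using assms by (simp add: c_def)
  also have "\<dots> = (\<Sum>z\<in>f ` X. \<Sum>u\<in>{x \<in> X. f x = z}. c (f u))"
    by (rule sum.image_gen[OF assms])
  also have "\<dots> = (\<Sum>z\<in>f ` X. c z ^ 2)"
    by (intro sum.cong refl) (simp add: c_def power2_eq_square)
  finally have 2: "card {(u, v). u \<in> X \<and> v \<in> X \<and> f u = f v} = (\<Sum>z\<in>f ` X. c z ^ 2)" .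
  have "real (card X ^ 2) \<le> real (card (f ` X) * card {(u, v). u \<in> X \<and> v \<in> X \<and> f u = f v})"
    using sum_squared_le_card_mult[of "f ` X" "\<lambda>z. real (c z)"] assms unfolding 1 2 by simp
  thus ?thesis by linarith
qed

text \<open>If c(v) counts the sets containing v, then the sum of |S a \<inter> S b| over all pairs
  is the sum of c(v)^2, which Cauchy-Schwarz bounds below by |A|^2 |V| / M^2. A best b reaches the
  average, and passing to the popular a costs the factors 2.\<close>

lemma popular_intersection:
  fixes M :: real
  assumes "finite A" "A \<noteq> {}" "finite V" "V \<noteq> {}" "0 < M"
    and S: "\<And>a. a \<in> A \<Longrightarrow> S a \<subseteq> V" "\<And>a. a \<in> A \<Longrightarrow> real (card V) \<le> M * card (S a)"
  obtains b where "b \<in> A"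
    "card A \<le> 2 * M\<^sup>2 * card {a \<in> A. card V \<le> 2 * M\<^sup>2 * card (S a \<inter> S b)}"
proof -
  define c where "c v = card {a \<in> A. v \<in> S a}" for v
  define n where "n = real (card V)"
  have n: "n > 0" using assms by (simp add: n_def card_gt_0_iff)
  have A: "real (card A) > 0" using assms by (simp add: card_gt_0_iff)
  have Sv: "{v \<in> V. v \<in> S a} = S a" if "a \<in> A" for a using S(1)[OF that] by blast
  have "(\<Sum>a\<in>A. card {v \<in> V. v \<in> S a}) = (\<Sum>v\<in>V. c v)"
    by (rule sum_multicount_gen) (use assms in \<open>auto simp: c_def\<close>)
  hence 1: "(\<Sum>a\<in>A. card (S a)) = (\<Sum>v\<in>V. c v)" by (simp add: Sv)
  have "(\<Sum>q\<in>A \<times> A. card {v \<in> V. v \<in> S (fst q) \<and> v \<in> S (snd q)}) = (\<Sum>v\<in>V. c v ^ 2)"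
  proof (rule sum_multicount_gen)
    show "\<forall>v\<in>V. card {q \<in> A \<times> A. v \<in> S (fst q) \<and> v \<in> S (snd q)} = c v ^ 2"
    proof
      fix v
      have "{q \<in> A \<times> A. v \<in> S (fst q) \<and> v \<in> S (snd q)} = {a \<in> A. v \<in> S a} \<times> {a \<in> A. v \<in> S a}" by auto
      thus "card {q \<in> A \<times> A. v \<in> S (fst q) \<and> v \<in> S (snd q)} = c v ^ 2"
        by (simp add: c_def power2_eq_square card_cartesian_product)
    qed
  qed (use assms in auto)
  moreover have "{v \<in> V. v \<in> S (fst q) \<and> v \<in> S (snd q)} = S (snd q) \<inter> S (fst q)" if "q \<in> A \<times> A" for q
    using S(1) that by force
  ultimately have 2: "(\<Sum>b\<in>A. \<Sum>a\<in>A. card (S a \<inter> S b)) = (\<Sum>v\<in>V. c v ^ 2)"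
    by (simp add: sum.cartesian_product case_prod_beta)
  have "card A * n / M \<le> (\<Sum>a\<in>A. real (card (S a)))"
    using sum_bounded_below[of A "n / M" "\<lambda>a. real (card (S a))"] S(2) assms(5)
    by (simp add: n_def field_simps)
  also have "\<dots> = (\<Sum>v\<in>V. real (c v))" using arg_cong[OF 1, of real] by simp
  finally have "(card A * n / M)\<^sup>2 \<le> (\<Sum>v\<in>V. real (c v))\<^sup>2"
    using n assms(5) by (intro power_mono) auto
  also have "\<dots> \<le> n * (\<Sum>v\<in>V. (real (c v))\<^sup>2)"
    unfolding n_def by (rule sum_squared_le_card_mult) fact
  also have "(\<Sum>v\<in>V. (real (c v))\<^sup>2) = (\<Sum>b\<in>A. \<Sum>a\<in>A. real (card (S a \<inter> S b)))"
    using arg_cong[OF 2, of real] by simp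
  finally have 3: "real (card A) * (card A * n / M\<^sup>2) \<le> (\<Sum>b\<in>A. \<Sum>a\<in>A. real (card (S a \<inter> S b)))"
    using n assms(5) by (simp add: power2_eq_square field_simps)
  have "\<exists>b\<in>A. card A * n / M\<^sup>2 \<le> (\<Sum>a\<in>A. real (card (S a \<inter> S b)))"
  proof (rule ccontr)
    assume "\<not> ?thesis"
    hence "(\<Sum>b\<in>A. \<Sum>a\<in>A. real (card (S a \<inter> S b))) < (\<Sum>b\<in>A. card A * n / M\<^sup>2)"
      using assms by (intro sum_strict_mono) (auto simp: not_le)
    thus False using 3 by simp
  qed
  then obtain b where b: "b \<in> A" "card A * n / M\<^sup>2 \<le> (\<Sum>a\<in>A. real (card (S a \<inter> S b)))" by blast
  have "(1 / M\<^sup>2) / 2 * card A \<le> card {a \<in> A. (1 / M\<^sup>2) / 2 * n \<le> real (card (S a \<inter> S b))}"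
  proof (rule card_popular)
    fix a assume "a \<in> A"
    show "real (card (S a \<inter> S b)) \<le> n"
      unfolding n_def using assms S(1)[OF \<open>a \<in> A\<close>] by (auto intro!: card_mono)
  qed (use assms n b in \<open>auto simp: field_simps\<close>)
  moreover have "(1 / M\<^sup>2) / 2 * n \<le> real k \<longleftrightarrow> card V \<le> 2 * M\<^sup>2 * real k" for k
    using assms(5) by (simp add: n_def field_simps)
  ultimately have "(1 / M\<^sup>2) / 2 * card A \<le> card {a \<in> A. card V \<le> 2 * M\<^sup>2 * card (S a \<inter> S b)}"
    by simp
  hence "card A \<le> 2 * M\<^sup>2 * card {a \<in> A. card V \<le> 2 * M\<^sup>2 * card (S a \<inter> S b)}"
    using assms(5) by (simp add: field_simps)
  thus ?thesis using that b(1) by blast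
qed

text \<open>The neighbourhood of a random vertex contains few pairs with few common neighbours; this
  gives many paths of length two, and then many paths of length three.\<close>

lemma balog_szemeredi_gowers:
  fixes E :: "('a \<times> 'a) set" and K :: real
  assumes "finite B" "B \<noteq> {}" "E \<subseteq> B \<times> B" "1 \<le> K" "(real (card B))\<^sup>2 \<le> K * card E"
  obtains P R where "P \<subseteq> B" "R \<subseteq> B" "card B \<le> 6 * K * card P" "card B \<le> 6 * K * card R"
    "\<And>x y. x \<in> P \<Longrightarrow> y \<in> R \<Longrightarrow>
      (real (card B))\<^sup>2 \<le> 3072 * K ^ 5 * card {(u, v). (x, v) \<in> E \<and> (u, v) \<in> E \<and> (u, y) \<in> E}"
proof -
  define n where "n = real (card B)"
  have n: "n > 0" using assms by (simp add: n_def card_gt_0_iff)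
  have K: "K > 0" using assms by simp
  \<comment> \<open>A pair is bad if it has fewer than \<theta> n common neighbours, and \<eta> is
    the tolerated proportion of bad pairs. They are tuned so that \<theta> / \<eta> = 1 / (8K^2),
    half of the constant in the second moment bound \<open>T2\<close>.\<close>
  define \<eta> \<theta> where "\<eta> = 1 / (16 * K)" and "\<theta> = 1 / (128 * K ^ 3)"
  have \<eta>: "\<eta> > 0" using K by (simp add: \<eta>_def)
  define \<Gamma> where "\<Gamma> u = {v \<in> B. (u, v) \<in> E}" for u
  have fin\<Gamma>: "finite (\<Gamma> u)" for u using assms by (simp add: \<Gamma>_def)
  \<comment> \<open>Dropping the vertices of small degree costs at most half of the edges; the
    degree bound for the remaining ones later makes \<open>R\<close> large.\<close>
  define U0 where "U0 = {u \<in> B. n \<le> 2 * K * card (\<Gamma> u)}"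
  have finU0: "finite U0" using assms by (simp add: U0_def)
  have "E = Sigma B \<Gamma>" using assms by (auto simp: \<Gamma>_def)
  hence "real (card E) = (\<Sum>u\<in>B. real (card (\<Gamma> u)))" using assms fin\<Gamma> by simp
  also have "\<dots> = (\<Sum>u\<in>B - U0. real (card (\<Gamma> u))) + (\<Sum>u\<in>U0. real (card (\<Gamma> u)))"
    using assms by (intro sum.subset_diff) (auto simp: U0_def)
  also have "(\<Sum>u\<in>B - U0. real (card (\<Gamma> u))) \<le> card (B - U0) * (n / (2 * K))"
    using K by (intro sum_bounded_above) (auto simp: U0_def field_simps)
  also have "\<dots> \<le> n * (n / (2 * K))"
    unfolding n_def using K assms by (intro mult_right_mono) (auto intro: card_mono)
  finally have "n\<^sup>2 / K - n * (n / (2 * K)) \<le> (\<Sum>u\<in>U0. real (card (\<Gamma> u)))"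
    using assms(5) K by (simp add: n_def field_simps)
  moreover have "n\<^sup>2 / K - n * (n / (2 * K)) = n\<^sup>2 / (2 * K)" using K by (simp add: field_simps power2_eq_square)
  ultimately have sum\<Gamma>: "n\<^sup>2 / (2 * K) \<le> (\<Sum>u\<in>U0. real (card (\<Gamma> u)))" by simp
  define T where "T v = {u \<in> U0. (u, v) \<in> E}" for v
  have "(\<Sum>u\<in>U0. card {v \<in> B. (u, v) \<in> E}) = (\<Sum>v\<in>B. card (T v))"
    by (rule sum_multicount_gen) (use assms finU0 in \<open>auto simp: T_def\<close>)
  hence "(\<Sum>u\<in>U0. real (card (\<Gamma> u))) = (\<Sum>v\<in>B. real (card (T v)))"
    unfolding \<Gamma>_def by (simp flip: of_nat_sum)
  hence "(n\<^sup>2 / (2 * K))\<^sup>2 \<le> (\<Sum>v\<in>B. real (card (T v)))\<^sup>2"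
    using sum\<Gamma> n K by (intro power_mono) auto
  also have "\<dots> \<le> n * (\<Sum>v\<in>B. (real (card (T v)))\<^sup>2)"
    unfolding n_def by (rule sum_squared_le_card_mult) fact
  finally have T2: "n ^ 3 / (4 * K\<^sup>2) \<le> (\<Sum>v\<in>B. (real (card (T v)))\<^sup>2)"
    using n K by (simp add: field_simps power2_eq_square power3_eq_cube)
  define cod where "cod u u' = {v \<in> B. (u, v) \<in> E \<and> (u', v) \<in> E}" for u u'
  define Bd where "Bd = {q \<in> U0 \<times> U0. card (cod (fst q) (snd q)) < \<theta> * n}"
  define bad where "bad v = {q \<in> Bd. fst q \<in> T v \<and> snd q \<in> T v}" for v
  have finBd: "finite Bd" using finU0 by (simp add: Bd_def)
  have "(\<Sum>q\<in>Bd. card {v \<in> B. fst q \<in> T v \<and> snd q \<in> T v}) = (\<Sum>v\<in>B. card (bad v))"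
    by (rule sum_multicount_gen) (use assms finBd in \<open>auto simp: bad_def\<close>)
  moreover have "{v \<in> B. fst q \<in> T v \<and> snd q \<in> T v} = cod (fst q) (snd q)" if "q \<in> Bd" for q
    using that by (auto simp: Bd_def T_def cod_def)
  ultimately have "(\<Sum>v\<in>B. real (card (bad v))) = (\<Sum>q\<in>Bd. real (card (cod (fst q) (snd q))))"
    by (metis (mono_tags, lifting) of_nat_sum sum.cong)
  also have "\<dots> \<le> card Bd * (\<theta> * n)" by (intro sum_bounded_above) (auto simp: Bd_def)
  also have "\<dots> \<le> n\<^sup>2 * (\<theta> * n)"
  proof (rule mult_right_mono)
    have "card Bd \<le> card (B \<times> B)"
      by (rule card_mono) (use assms in \<open>auto simp: Bd_def U0_def\<close>)
    thus "real (card Bd) \<le> n\<^sup>2"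
      unfolding n_def power2_eq_square by (metis card_cartesian_product of_nat_le_iff of_nat_mult)
  qed (use n K in \<open>simp add: \<theta>_def\<close>)
  finally have sumbad: "(\<Sum>v\<in>B. real (card (bad v))) \<le> \<theta> * n ^ 3"
    by (simp add: power2_eq_square power3_eq_cube algebra_simps)
  \<comment> \<open>Averaging one weighted difference yields a single vertex whose neighbourhood is
    large and, at the same time, has few bad pairs.\<close>
  have "\<exists>v\<in>B. n\<^sup>2 / (8 * K\<^sup>2) \<le> (real (card (T v)))\<^sup>2 - card (bad v) / \<eta>"
  proof (rule ccontr)
    assume "\<not> ?thesis"
    hence "(\<Sum>v\<in>B. (real (card (T v)))\<^sup>2 - card (bad v) / \<eta>) < (\<Sum>v\<in>B. n\<^sup>2 / (8 * K\<^sup>2))"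
      using assms by (intro sum_strict_mono) (auto simp: not_le)
    hence 1: "(\<Sum>v\<in>B. (real (card (T v)))\<^sup>2) - (\<Sum>v\<in>B. real (card (bad v))) / \<eta> < n ^ 3 / (8 * K\<^sup>2)"
      by (simp add: sum_subtractf sum_divide_distrib n_def power2_eq_square power3_eq_cube)
    have "(\<Sum>v\<in>B. real (card (bad v))) / \<eta> \<le> \<theta> * n ^ 3 / \<eta>"
      using sumbad \<eta> by (intro divide_right_mono) auto
    also have "\<dots> = n ^ 3 / (8 * K\<^sup>2)"
      using K by (simp add: \<theta>_def \<eta>_def field_simps power2_eq_square power3_eq_cube)
    finally have "n ^ 3 / (4 * K\<^sup>2) - n ^ 3 / (8 * K\<^sup>2) < n ^ 3 / (8 * K\<^sup>2)" using 1 T2 by linarith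
    thus False by simp
  qed
  then obtain w where w: "w \<in> B" "n\<^sup>2 / (8 * K\<^sup>2) \<le> (real (card (T w)))\<^sup>2 - card (bad w) / \<eta>" by blast
  define U where "U = T w"
  have finU: "finite U" and U0: "U \<subseteq> U0" using finU0 by (auto simp: U_def T_def)
  define m where "m = real (card U)"
  have "0 \<le> card (bad w) / \<eta>" using \<eta> by simp
  hence "n\<^sup>2 / (8 * K\<^sup>2) \<le> m\<^sup>2" using w(2) by (simp add: m_def U_def)
  hence "n\<^sup>2 \<le> 8 * K\<^sup>2 * m\<^sup>2" using K by (simp add: field_simps)
  also have "\<dots> \<le> (3 * K * m)\<^sup>2" by (simp add: power_mult_distrib)
  finally have nm: "n \<le> 3 * K * m"
    using K by (simp add: m_def abs_le_square_iff[symmetric] abs_mult n_def)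
  hence m: "m > 0" using n K by (metis less_le_trans zero_less_mult_pos mult_pos_pos zero_less_numeral)
  have "0 \<le> n\<^sup>2 / (8 * K\<^sup>2)" by simp
  hence "card (bad w) / \<eta> \<le> m\<^sup>2" using w(2) unfolding m_def U_def by linarith
  hence badm: "card (bad w) \<le> \<eta> * m\<^sup>2" using \<eta> by (simp add: field_simps)
  define bp where "bp x = {u \<in> U. (x, u) \<in> Bd}" for x
  have "bad w = Sigma U bp" by (auto simp: bad_def bp_def U_def)
  hence sumbp: "(\<Sum>x\<in>U. real (card (bp x))) \<le> \<eta> * m\<^sup>2" using badm finU by (simp add: bp_def)
  \<comment> \<open>By Markov's inequality at most half of \<open>U\<close> lies in more than twice
    the average number of bad pairs.\<close>
  define P where "P = {x \<in> U. card (bp x) \<le> 2 * \<eta> * m}"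
  have "card (U - P) * (2 * \<eta> * m) \<le> (\<Sum>x\<in>U - P. real (card (bp x)))"
    by (intro sum_bounded_below) (auto simp: P_def)
  also have "\<dots> \<le> (\<Sum>x\<in>U. real (card (bp x)))" using finU by (intro sum_mono2) auto
  also note sumbp
  finally have "card (U - P) * 2 \<le> m" using \<eta> m by (simp add: power2_eq_square field_simps)
  moreover have "real (card (U - P)) = m - card P"
    using finU card_mono[of U P] by (subst card_Diff_subset) (auto simp: m_def P_def intro: finite_subset)
  ultimately have mP: "m \<le> 2 * card P" by simp
  define \<Delta> where "\<Delta> y = {u \<in> U. (u, y) \<in> E}" for y
  have fin\<Delta>: "finite (\<Delta> y)" for y using finU by (simp add: \<Delta>_def)
  \<comment> \<open>The vertices of \<open>U\<close> send at least m n / (2K) edges into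
    \<open>B\<close>; endpoints receiving fewer than m / (4K) of them account for at most
    half.\<close>
  define R where "R = {y \<in> B. m \<le> 4 * K * card (\<Delta> y)}"
  have "(\<Sum>u\<in>U. card {y \<in> B. (u, y) \<in> E}) = (\<Sum>y\<in>B. card (\<Delta> y))"
    by (rule sum_multicount_gen) (use assms finU in \<open>auto simp: \<Delta>_def\<close>)
  hence "(\<Sum>u\<in>U. real (card (\<Gamma> u))) = (\<Sum>y\<in>B. real (card (\<Delta> y)))"
    unfolding \<Gamma>_def by (simp flip: of_nat_sum)
  moreover have "m * (n / (2 * K)) \<le> (\<Sum>u\<in>U. real (card (\<Gamma> u)))"
    unfolding m_def using U0 K by (intro sum_bounded_below) (auto simp: U0_def field_simps)
  ultimately have "m * (n / (2 * K)) \<le> (\<Sum>y\<in>B. real (card (\<Delta> y)))" by simp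
  also have "\<dots> = (\<Sum>y\<in>B - R. real (card (\<Delta> y))) + (\<Sum>y\<in>R. real (card (\<Delta> y)))"
    using assms by (intro sum.subset_diff) (auto simp: R_def)
  also have "(\<Sum>y\<in>B - R. real (card (\<Delta> y))) \<le> card (B - R) * (m / (4 * K))"
    using K by (intro sum_bounded_above) (auto simp: R_def field_simps)
  also have "\<dots> \<le> n * (m / (4 * K))"
    unfolding n_def using K assms m by (intro mult_right_mono) (auto intro: card_mono)
  also have "(\<Sum>y\<in>R. real (card (\<Delta> y))) \<le> card R * m"
    unfolding m_def using finU by (intro sum_bounded_above) (auto simp: \<Delta>_def intro: card_mono)
  finally have "m * (n / (4 * K)) \<le> m * card R" by (simp add: algebra_simps)
  hence nR: "n \<le> 4 * K * card R" using m K by (simp add: field_simps)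
  show ?thesis
  proof (rule that)
    show "P \<subseteq> B" "R \<subseteq> B" using U0 by (auto simp: P_def R_def U0_def)
    have "3 * K * m \<le> 3 * K * (2 * card P)" using mP K by (intro mult_left_mono) auto
    thus "card B \<le> 6 * K * card P" using nm by (simp add: n_def)
    have "4 * K * card R \<le> 6 * K * card R" using K by (intro mult_right_mono) auto
    thus "card B \<le> 6 * K * card R" using nR unfolding n_def by linarith
    \<comment> \<open>Of the neighbours u of y in \<open>U\<close>, at least m/(4K) - 2 \<eta> m =
      m/(8K) are not bad partners of x, and each has \<theta> n common neighbours v with x. As m
      \<ge> n/(3K), this gives (n / (24K^2)) * \<theta> n paths, and 24 * 128 = 3072.\<close>
    fix x y assume x: "x \<in> P" and y: "y \<in> R"
    have "m / (4 * K) \<le> card (\<Delta> y)" "real (card (bp x)) \<le> 2 * \<eta> * m"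
      using x y K by (auto simp: P_def R_def field_simps)
    hence "m / (4 * K) - 2 * \<eta> * m \<le> real (card (\<Delta> y)) - real (card (bp x))" by linarith
    also have "m / (4 * K) - 2 * \<eta> * m = m / (8 * K)" using K by (simp add: \<eta>_def field_simps)
    also have "real (card (\<Delta> y)) - real (card (bp x)) \<le> card (\<Delta> y - bp x)"
      using diff_card_le_card_Diff[of "bp x" "\<Delta> y"] finU by (simp add: bp_def)
    finally have Z: "m / (8 * K) \<le> card (\<Delta> y - bp x)" .
    have "card (\<Delta> y - bp x) * (\<theta> * n) \<le> (\<Sum>u\<in>\<Delta> y - bp x. real (card (cod x u)))"
    proof (rule sum_bounded_below)
      fix u assume "u \<in> \<Delta> y - bp x"
      thus "\<theta> * n \<le> card (cod x u)" using x U0 by (auto simp: \<Delta>_def bp_def Bd_def P_def)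
    qed
    also have "\<dots> = card (SIGMA u:\<Delta> y - bp x. cod x u)"
      using fin\<Delta> assms(1) by (simp add: cod_def)
    also have "\<dots> \<le> card {(u, v). (x, v) \<in> E \<and> (u, v) \<in> E \<and> (u, y) \<in> E}"
    proof (intro of_nat_mono card_mono)
      have "{(u, v). (x, v) \<in> E \<and> (u, v) \<in> E \<and> (u, y) \<in> E} \<subseteq> B \<times> B" using assms by auto
      thus "finite {(u, v). (x, v) \<in> E \<and> (u, v) \<in> E \<and> (u, y) \<in> E}"
        using assms(1) finite_subset by blast
    qed (auto simp: cod_def \<Delta>_def)
    finally have "card (\<Delta> y - bp x) * (\<theta> * n) \<le> card {(u, v). (x, v) \<in> E \<and> (u, v) \<in> E \<and> (u, y) \<in> E}" .
    moreover have "(n / (24 * K\<^sup>2)) * (\<theta> * n) \<le> card (\<Delta> y - bp x) * (\<theta> * n)"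
    proof (rule mult_right_mono)
      have "n / (24 * K\<^sup>2) \<le> m / (8 * K)" using nm K by (simp add: field_simps power2_eq_square)
      thus "n / (24 * K\<^sup>2) \<le> card (\<Delta> y - bp x)" using Z by linarith
    qed (use n K in \<open>simp add: \<theta>_def\<close>)
    moreover have "(n / (24 * K\<^sup>2)) * (\<theta> * n) = n\<^sup>2 / (3072 * K ^ 5)"
      by (simp add: \<theta>_def power2_eq_square power3_eq_cube numeral_eq_Suc)
    ultimately have "n\<^sup>2 / (3072 * K ^ 5) \<le> card {(u, v). (x, v) \<in> E \<and> (u, v) \<in> E \<and> (u, y) \<in> E}"
      by linarith
    thus "(real (card B))\<^sup>2 \<le> 3072 * K ^ 5 * card {(u, v). (x, v) \<in> E \<and> (u, v) \<in> E \<and> (u, y) \<in> E}"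
      using K by (simp add: n_def field_simps)
  qed
qed

section \<open>Additive energy averaged over all dilations\<close>

context prime_modulus
begin

text \<open>Two different pairs (a, b) and (c, d) satisfy a - xb = c - xd for at most one residue x.
  The energies \<open>En x\<close> over nonzero x therefore add up to at most r^2 (p - 1) + r^4,
  while closeness makes each of them at least r^3 / W, provided W is positive. One of the two
  summands must account for half of the lower bound.\<close>

lemma close_all_imp:
  fixes W :: real
  assumes R: "R \<subseteq> {0..<p}" "R \<noteq> {}" and W: "0 \<le> W" "\<And>x. close R W x"
  shows "card R \<le> 2 * W \<or> p - 1 \<le> 2 * W * card R"
proof -
  have finR: "finite R" using R finite_subset by blast
  define r where "r = real (card R)"
  have r: "r > 0" using R finR by (simp add: r_def card_gt_0_iff)
  let ?f = "\<lambda>x (a, b). (a - x * b) mod p"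
  let ?X = "R \<times> R"
  define En where "En x = card {q \<in> ?X \<times> ?X. ?f x (fst q) = ?f x (snd q)}" for x
  have En: "r ^ 3 \<le> W * En x" for x
  proof -
    have "{(u, v). u \<in> ?X \<and> v \<in> ?X \<and> ?f x u = ?f x v} = {q \<in> ?X \<times> ?X. ?f x (fst q) = ?f x (snd q)}"
      by auto
    hence "card ?X ^ 2 \<le> card (?f x ` ?X) * En x"
      using card_squared_le_image_mult_collisions[of ?X "?f x"] finR by (simp add: En_def)
    also have "card (?f x ` ?X) = N (diffset R (dilate x R))"
      unfolding N_def diffset_def dilate_def
      by (rule arg_cong[where f = card]) (force simp: image_iff)
    finally have "real (card ?X ^ 2) \<le> real (N (diffset R (dilate x R)) * En x)" by (rule of_nat_mono)
    hence "r ^ 4 \<le> real (N (diffset R (dilate x R))) * En x"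
      by (simp add: r_def card_cartesian_product power2_eq_square numeral_eq_Suc)
    also have "\<dots> \<le> W * r * En x"
      using W(2)[of x] N_eq_card[OF R(1)] unfolding close_def r_def by (intro mult_right_mono) auto
    finally have "r * r ^ 3 \<le> r * (W * En x)" by (simp add: numeral_eq_Suc algebra_simps)
    thus ?thesis using r by simp
  qed
  have "(\<Sum>x\<in>{1..<p}. En x) = (\<Sum>q\<in>?X \<times> ?X. card {x \<in> {1..<p}. ?f x (fst q) = ?f x (snd q)})"
    unfolding En_def by (rule sum_multicount_gen) (use finR in auto)
  also have "\<dots> \<le> (\<Sum>q\<in>?X \<times> ?X. (if fst q = snd q then nat (p - 1) else 0) + 1)"
  proof (rule sum_mono)
    fix q assume "q \<in> ?X \<times> ?X"
    then obtain a b c d where q: "q = ((a, b), (c, d))" and abcd: "a \<in> R" "b \<in> R" "c \<in> R" "d \<in> R" by auto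
    show "card {x \<in> {1..<p}. ?f x (fst q) = ?f x (snd q)} \<le> (if fst q = snd q then nat (p - 1) else 0) + 1"
    proof (cases "fst q = snd q")
      case True
      have "card {x \<in> {1..<p}. ?f x (fst q) = ?f x (snd q)} \<le> card {1..<p}" by (intro card_mono) auto
      thus ?thesis using True by simp
    next
      case False
      have "x = y" if x: "x \<in> {1..<p}" "(a - x * b) mod p = (c - x * d) mod p"
        and y: "y \<in> {1..<p}" "(a - y * b) mod p = (c - y * d) mod p" for x y
      proof -
        have dx: "p dvd (a - c) - x * (b - d)" and dy: "p dvd (a - c) - y * (b - d)"
          using x(2) y(2) by (simp_all add: mod_eq_dvd_iff algebra_simps)
        have "p dvd ((a - c) - y * (b - d)) - ((a - c) - x * (b - d))" by (rule dvd_diff[OF dy dx])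
        hence "p dvd (x - y) * (b - d)" by (simp add: algebra_simps)
        moreover have "\<not> p dvd b - d"
        proof
          assume bd: "p dvd b - d"
          hence "b = d" using dvd_diff_residues abcd R by blast
          moreover have "a = c"
          proof -
            have "p dvd a - c" using dx bd \<open>b = d\<close> by simp
            thus ?thesis using dvd_diff_residues abcd R by blast
          qed
          ultimately show False using False q by simp
        qed
        ultimately have "p dvd x - y" using prime by (simp add: prime_dvd_mult_iff)
        thus ?thesis using dvd_diff_residues x(1) y(1) by auto
      qed
      hence "card {x \<in> {1..<p}. ?f x (fst q) = ?f x (snd q)} \<le> Suc 0"
        unfolding q by (subst card_le_Suc0_iff_eq) (auto intro: finite_subset[of _ "{1..<p}"])
      thus ?thesis using False by simp
    qed
  qed
  also have "\<dots> = card {q \<in> ?X \<times> ?X. fst q = snd q} * nat (p - 1) + card (?X \<times> ?X)"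
    using finR by (subst sum.distrib) (simp add: sum.If_cases Int_def flip: sum.inter_filter)
  also have "{q \<in> ?X \<times> ?X. fst q = snd q} = (\<lambda>u. (u, u)) ` ?X" by auto
  also have "card \<dots> = card ?X" by (rule card_image) (auto simp: inj_on_def)
  finally have "(\<Sum>x\<in>{1..<p}. En x) \<le> card ?X * nat (p - 1) + card (?X \<times> ?X)" .
  hence "real (\<Sum>x\<in>{1..<p}. En x) \<le> real (card ?X * nat (p - 1) + card (?X \<times> ?X))" by (rule of_nat_mono)
  also have "\<dots> = r\<^sup>2 * (p - 1) + r ^ 4"
    using p_pos by (simp add: r_def card_cartesian_product numeral_eq_Suc)
  finally have S: "(\<Sum>x\<in>{1..<p}. real (En x)) \<le> r\<^sup>2 * (p - 1) + r ^ 4" by simp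
  have "(p - 1) * r ^ 3 = (\<Sum>x\<in>{1..<p}. r ^ 3)" using p_pos by simp
  also have "\<dots> \<le> (\<Sum>x\<in>{1..<p}. W * En x)" using En by (rule sum_mono)
  also have "\<dots> \<le> W * (r\<^sup>2 * (p - 1) + r ^ 4)"
    using S W(1) by (subst sum_distrib_left[symmetric]) (intro mult_left_mono)
  finally have "r\<^sup>2 * ((p - 1) * r) \<le> r\<^sup>2 * (W * ((p - 1) + r\<^sup>2))"
    by (simp add: algebra_simps power2_eq_square numeral_eq_Suc)
  hence main: "(p - 1) * r \<le> W * ((p - 1) + r\<^sup>2)" using r by simp
  show ?thesis
  proof (rule ccontr)
    assume "\<not> ?thesis"
    hence a: "2 * W < r" and b: "2 * W * r < p - 1" by (auto simp: r_def not_le)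
    have p1: "real_of_int p - 1 > 0" using p_gt_1 by simp
    have "2 * W * (p - 1) < r * (p - 1)" using a p1 by (intro mult_strict_right_mono) auto
    moreover have "(2 * W * r) * r < (p - 1) * r" using b r by (intro mult_strict_right_mono) auto
    ultimately show False using main by (simp add: algebra_simps power2_eq_square)
  qed
qed

end

section \<open>A set with many partially small differences\<close>

context prime_modulus
begin

text \<open>With all sizes measured against one n in powers of L, a chain of triangle inequalities
  only adds exponents; \<open>k\<close> is the loss from a pivot smaller than n.\<close>

lemma ruzsa_triangle_scaled:
  fixes L n :: real
  assumes "N (diffset A B) \<le> L ^ i * n" "N (diffset B C) \<le> L ^ j * n" "n \<le> L ^ k * N B" "1 \<le> L" "0 < n"
  shows "N (diffset A C) \<le> L ^ (i + j + k) * n"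
proof -
  have "n * N (diffset A C) \<le> L ^ k * N B * N (diffset A C)"
    using assms(3) by (intro mult_right_mono) auto
  also have "\<dots> = L ^ k * real (N B * N (diffset A C))" by simp
  also have "\<dots> \<le> L ^ k * real (N (diffset A B) * N (diffset B C))"
    using assms(4) by (intro mult_left_mono of_nat_mono ruzsa_triangle) auto
  also have "\<dots> \<le> L ^ k * ((L ^ i * n) * (L ^ j * n))"
    unfolding of_nat_mult using assms by (intro mult_left_mono mult_mono) auto
  also have "\<dots> = n * (L ^ (i + j + k) * n)" by (simp add: power_add)
  finally show ?thesis using assms(5) by simp
qed

text \<open>A path of length three writes xb - yc as (xb - yv) - (xu - yv) + (xu - yc) with all
  three terms in \<open>Lam\<close>. There are at most (L n)^3 triples, and each difference has at
  least n^2 / (3072 L^5) representations, so at most 3072 L^8 n differences occur. The hypothesis 6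
  \<le> L absorbs constants: 3072 \<le> 6^5 and 6L \<le> L^2.\<close>

lemma partial_difference_subsets:
  fixes L :: real
  assumes B: "B \<subseteq> {0..<p}" "B \<noteq> {}" and L: "6 \<le> L"
    and Lam: "finite Lam" "real (card Lam) \<le> L * card B"
    and xy: "\<not> p dvd x" "\<not> p dvd y"
    and E: "(real (card B))\<^sup>2 \<le> L * card {(b, c). b \<in> B \<and> c \<in> B \<and> (x * b - y * c) mod p \<in> Lam}"
  shows "\<exists>P R. P \<subseteq> B \<and> R \<subseteq> B \<and> card B \<le> L ^ 2 * card P \<and> card B \<le> L ^ 2 * card R \<and>
    N (diffset (dilate x P) (dilate y R)) \<le> L ^ 13 * card B"
proof -
  have finB: "finite B" using B(1) finite_subset by blast
  define n where "n = real (card B)"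
  have n: "n > 0" using B finB by (simp add: n_def card_gt_0_iff)
  define E where "E = {(b, c). b \<in> B \<and> c \<in> B \<and> (x * b - y * c) mod p \<in> Lam}"
  have "E \<subseteq> B \<times> B" by (auto simp: E_def)
  then obtain P R where PR: "P \<subseteq> B" "R \<subseteq> B" "card B \<le> 6 * L * card P" "card B \<le> 6 * L * card R"
    and paths: "\<And>b c. b \<in> P \<Longrightarrow> c \<in> R \<Longrightarrow>
      (real (card B))\<^sup>2 \<le> 3072 * L ^ 5 * card {(u, v). (b, v) \<in> E \<and> (u, v) \<in> E \<and> (u, c) \<in> E}"
    using balog_szemeredi_gowers[of B E L] finB B L E unfolding E_def by auto
  let ?Z = "(\<lambda>z. z mod p) ` diffset (dilate x P) (dilate y R)"
  have "\<forall>z\<in>?Z. \<exists>b c. b \<in> P \<and> c \<in> R \<and> (x * b - y * c) mod p = z"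
    by (auto simp: diffset_def dilate_def)
  then obtain g h where gh: "\<And>z. z \<in> ?Z \<Longrightarrow> g z \<in> P \<and> h z \<in> R \<and> (x * g z - y * h z) mod p = z"
    by metis
  define W where "W z = {(u, v). (g z, v) \<in> E \<and> (u, v) \<in> E \<and> (u, h z) \<in> E}" for z
  have finW: "finite (W z)" for z
    by (rule finite_subset[of _ "B \<times> B"]) (use finB in \<open>auto simp: W_def E_def\<close>)
  let ?F = "\<lambda>(z, u, v). ((x * g z - y * v) mod p, (x * u - y * v) mod p, (x * u - y * h z) mod p)"
  \<comment> \<open>The alternating sum of the triple recovers z, hence the chosen
    \<open>g z\<close> and \<open>h z\<close>; then v and u follow because y and x are invertible
    modulo \<open>p\<close>.\<close>
  have "inj_on ?F (Sigma ?Z W)"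
  proof (rule inj_onI)
    fix q q' assume q: "q \<in> Sigma ?Z W" "q' \<in> Sigma ?Z W" "?F q = ?F q'"
    obtain z u v z' u' v' where qq: "q = (z, u, v)" "q' = (z', u', v')" by (metis prod.collapse)
    have z: "z \<in> ?Z" "(u, v) \<in> W z" "z' \<in> ?Z" "(u', v') \<in> W z'"
      using q(1,2) unfolding qq by blast+
    have e1: "(x * g z - y * v) mod p = (x * g z' - y * v') mod p"
      and e2: "(x * u - y * v) mod p = (x * u' - y * v') mod p"
      and e3: "(x * u - y * h z) mod p = (x * u' - y * h z') mod p"
      using q(3) unfolding qq by simp_all
    have "((x * g z - y * v) - (x * u - y * v) + (x * u - y * h z)) mod p
        = ((x * g z' - y * v') - (x * u' - y * v') + (x * u' - y * h z')) mod p"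
      by (rule mod_add_cong[OF mod_diff_cong[OF e1 e2] e3])
    hence zz: "z = z'" using gh[OF z(1)] gh[OF z(3)] by simp
    have "(x * g z - (x * g z - y * v)) mod p = (x * g z - (x * g z' - y * v')) mod p"
      by (rule mod_diff_cong[OF refl e1])
    hence "(y * v) mod p = (y * v') mod p" by (simp add: zz)
    hence "v mod p = v' mod p" using mult_mod_cancel[of y v v'] xy by blast
    moreover have "((x * u - y * h z) + y * h z) mod p = ((x * u' - y * h z') + y * h z) mod p"
      by (rule mod_add_cong[OF e3 refl])
    hence "u mod p = u' mod p" using mult_mod_cancel[of x u u'] xy by (simp add: zz)
    moreover have "u \<in> {0..<p}" "u' \<in> {0..<p}" "v \<in> {0..<p}" "v' \<in> {0..<p}"
      using z(2,4) B(1) by (auto simp: W_def E_def)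
    ultimately show "q = q'" using zz by (simp add: qq)
  qed
  moreover have "?F ` Sigma ?Z W \<subseteq> Lam \<times> Lam \<times> Lam" by (auto simp: W_def E_def)
  ultimately have "card (Sigma ?Z W) \<le> card (Lam \<times> Lam \<times> Lam)"
    using Lam(1) by (intro card_inj_on_le) auto
  hence "real (card (Sigma ?Z W)) \<le> real (card Lam) ^ 3"
    by (simp add: card_cartesian_product power3_eq_cube flip: of_nat_mult)
  also have "\<dots> \<le> (L * n) ^ 3" using Lam(2) by (intro power_mono) (auto simp: n_def)
  finally have up: "real (card (Sigma ?Z W)) \<le> (L * n) ^ 3" .
  have "card ?Z * (n\<^sup>2 / (3072 * L ^ 5)) \<le> (\<Sum>z\<in>?Z. real (card (W z)))"
  proof (rule sum_bounded_below)
    fix z assume "z \<in> ?Z"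
    hence "n\<^sup>2 \<le> 3072 * L ^ 5 * card (W z)" using gh paths unfolding W_def n_def by blast
    thus "n\<^sup>2 / (3072 * L ^ 5) \<le> card (W z)" using L by (simp add: field_simps)
  qed
  also have "\<dots> = card (Sigma ?Z W)" using finW by simp
  also note up
  finally have "n\<^sup>2 * card ?Z \<le> n\<^sup>2 * (3072 * L ^ 8 * n)"
    using L by (simp add: field_simps power2_eq_square power3_eq_cube numeral_eq_Suc)
  hence "card ?Z \<le> 3072 * L ^ 8 * n" using n by simp
  also have "\<dots> \<le> L ^ 5 * L ^ 8 * n"
  proof (intro mult_right_mono)
    have "(6::real) ^ 5 \<le> L ^ 5" using L by (intro power_mono) auto
    thus "3072 \<le> L ^ 5" by simp
  qed (use L n in auto)
  finally have "N (diffset (dilate x P) (dilate y R)) \<le> L ^ 13 * n"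
    by (simp add: N_def flip: power_add)
  moreover have "card B \<le> L ^ 2 * card S" if "card B \<le> 6 * L * card S" for S :: "int set"
  proof -
    have "6 * L * card S \<le> L ^ 2 * card S"
      using L by (intro mult_right_mono) (auto simp: power2_eq_square)
    thus ?thesis using that by linarith
  qed
  ultimately show ?thesis using PR unfolding n_def by blast
qed

text \<open>Popularity makes the sets of \<open>partial_difference_subsets\<close> for many different \<open>a\<close> comparable
  to the ones for a single \<open>b\<close>; the triangle inequality then bounds \<open>a P - b P\<close>.\<close>

lemma many_close_dilations:
  fixes L :: real
  assumes B: "B \<subseteq> {0..<p}" "B \<noteq> {}" and L: "6 \<le> L"
    and Lam: "finite Lam" "real (card Lam) \<le> L * card B"
    and A: "A \<subseteq> {1..<p}" "A \<noteq> {}" and y: "\<not> p dvd y"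
    and E: "\<And>a. a \<in> A \<Longrightarrow>
      (real (card B))\<^sup>2 \<le> L * card {(b, c). b \<in> B \<and> c \<in> B \<and> (a * b - y * c) mod p \<in> Lam}"
  obtains P D where "P \<subseteq> B" "card B \<le> L ^ 2 * card P" "close P (L ^ 104) 1"
    "D \<subseteq> {0..<p}" "card A \<le> L ^ 9 * card D" "\<And>x. x \<in> D \<Longrightarrow> close P (L ^ 104) x"
proof -
  have finB: "finite B" using B(1) finite_subset by blast
  have finA: "finite A" using A(1) finite_subset by blast
  define n where "n = real (card B)"
  have n: "n > 0" using B finB by (simp add: n_def card_gt_0_iff)
  have L1: "1 \<le> L" "0 < L" using L by auto
  have nd: "\<not> p dvd a" if "a \<in> A" for a using A(1) that zdvd_not_zless by auto
  have "\<forall>a\<in>A. \<exists>P R. P \<subseteq> B \<and> R \<subseteq> B \<and> card B \<le> L ^ 2 * card P \<and> card B \<le> L ^ 2 * card R \<and>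
      N (diffset (dilate a P) (dilate y R)) \<le> L ^ 13 * card B"
    using partial_difference_subsets[OF B L Lam _ y E] nd by blast
  then obtain P R where PR: "\<And>a. a \<in> A \<Longrightarrow> P a \<subseteq> B \<and> R a \<subseteq> B \<and> n \<le> L ^ 2 * card (P a) \<and>
      n \<le> L ^ 2 * card (R a) \<and> N (diffset (dilate a (P a)) (dilate y (R a))) \<le> L ^ 13 * n"
    unfolding n_def by metis
  \<comment> \<open>The product sets have density L^(-4) in B \<times> B, so
    \<open>popular_intersection\<close> loses 2 L^8 \<le> L^9.\<close>
  have dens: "real (card (B \<times> B)) \<le> L ^ 4 * card (P a \<times> R a)" if "a \<in> A" for a
  proof -
    have "n * n \<le> (L ^ 2 * card (P a)) * (L ^ 2 * card (R a))"
      using PR[OF that] n by (intro mult_mono) auto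
    thus ?thesis by (simp add: n_def card_cartesian_product numeral_eq_Suc mult_ac)
  qed
  obtain b where b: "b \<in> A" and many: "card A \<le> 2 * (L ^ 4)\<^sup>2 *
      card {a \<in> A. card (B \<times> B) \<le> 2 * (L ^ 4)\<^sup>2 * card (P a \<times> R a \<inter> P b \<times> R b)}"
  proof (rule popular_intersection[of A "B \<times> B" "L ^ 4" "\<lambda>a. P a \<times> R a"])
    show "\<And>a. a \<in> A \<Longrightarrow> P a \<times> R a \<subseteq> B \<times> B" using PR by blast
  qed (use finA A(2) finB B(2) L1 dens in auto)
  define A' where "A' = {a \<in> A. card (B \<times> B) \<le> 2 * (L ^ 4)\<^sup>2 * card (P a \<times> R a \<inter> P b \<times> R b)}"
  have L9: "2 * (L ^ 4)\<^sup>2 \<le> L ^ 9"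
  proof -
    have "2 * (L ^ 4)\<^sup>2 \<le> L * (L ^ 4)\<^sup>2" using L by (intro mult_right_mono) auto
    thus ?thesis by (simp flip: power_mult power_Suc)
  qed
  have "2 * (L ^ 4)\<^sup>2 * card A' \<le> L ^ 9 * card A'" using L9 by (rule mult_right_mono) simp
  hence cardA': "card A \<le> L ^ 9 * card A'" using many unfolding A'_def by linarith
  have sub: "P a \<subseteq> {0..<p}" "R a \<subseteq> {0..<p}" if "a \<in> A" for a using PR[OF that] B(1) by auto
  have NP: "N (P b) = card (P b)" "N (R b) = card (R b)" using sub[OF b] N_eq_card by auto
  have nP: "n \<le> L ^ 2 * N (P b)" and nR: "n \<le> L ^ 2 * N (R b)" using PR[OF b] NP by auto
  have dPR: "N (diffset (dilate b (P b)) (dilate y (R b))) \<le> L ^ 13 * n" using PR[OF b] by blast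
  have dRP: "N (diffset (dilate y (R b)) (dilate b (P b))) \<le> L ^ 13 * n"
    using dPR by (simp add: N_diffset_commute)
  have "N (diffset (dilate b (P b)) (dilate b (P b))) \<le> L ^ (13 + 13 + 2) * n"
    using ruzsa_triangle_scaled[OF dPR dRP _ L1(1) n, of 2] nR y by (simp add: N_dilate)
  hence PP: "N (diffset (P b) (P b)) \<le> L ^ 28 * n"
    by (simp add: N_dilate nd[OF b] flip: dilate_diffset)
  have "N (diffset (dilate y (R b)) (dilate y (R b))) \<le> L ^ (13 + 13 + 2) * n"
    using ruzsa_triangle_scaled[OF dRP dPR _ L1(1) n, of 2] nP nd[OF b] by (simp add: N_dilate)
  hence RR: "N (diffset (R b) (R b)) \<le> L ^ 28 * n"
    by (simp add: N_dilate y flip: dilate_diffset)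
  \<comment> \<open>The chain runs through a P_b, a P', y R', y R_b and b P_b, where P' and R' are
    the intersections of the sets for a and b. The links cost 28, 13, 28, 13 and the three pivots 9,
    9, 2, in total 102.\<close>
  have key: "N (diffset (dilate b (P b)) (dilate a (P b))) \<le> L ^ 102 * n" if a: "a \<in> A'" for a
  proof -
    have aA: "a \<in> A" using a by (simp add: A'_def)
    define P' R' where "P' = P a \<inter> P b" and "R' = R a \<inter> R b"
    have sub': "P' \<subseteq> B" "R' \<subseteq> B" using PR[OF b] by (auto simp: P'_def R'_def)
    hence le: "real (card P') \<le> n" "real (card R') \<le> n"
      unfolding n_def using finB by (auto intro: card_mono)
    have "P a \<times> R a \<inter> P b \<times> R b = P' \<times> R'" by (auto simp: P'_def R'_def)
    hence "n * n \<le> 2 * (L ^ 4)\<^sup>2 * (real (card P') * card R')"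
      using a unfolding A'_def by (simp add: n_def card_cartesian_product)
    also have "\<dots> \<le> L ^ 9 * (real (card P') * card R')" using L9 by (intro mult_right_mono) auto
    finally have nn: "n * n \<le> L ^ 9 * (real (card P') * card R')" .
    have "L ^ 9 * (real (card P') * card R') \<le> L ^ 9 * (real (card P') * n)"
      using le L1 by (intro mult_left_mono) auto
    hence "n * n \<le> (L ^ 9 * card P') * n" using nn by (simp add: mult_ac)
    hence nP': "n \<le> L ^ 9 * N P'" using n sub' B(1) by (subst N_eq_card) auto
    have "L ^ 9 * (real (card P') * card R') \<le> L ^ 9 * (n * card R')"
      using le L1 by (intro mult_left_mono mult_right_mono) auto
    hence "n * n \<le> (L ^ 9 * card R') * n" using nn by (simp add: mult_ac)
    hence nR': "n \<le> L ^ 9 * N R'" using n sub' B(1) by (subst N_eq_card) auto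
    have "N (diffset (dilate a P') (dilate y R')) \<le> N (diffset (dilate a (P a)) (dilate y (R a)))"
      by (intro N_mono diffset_mono dilate_mono) (auto simp: P'_def R'_def)
    hence 1: "N (diffset (dilate a P') (dilate y R')) \<le> L ^ 13 * n" using PR[OF aA] by linarith
    have "N (diffset (dilate y R') (dilate y (R b))) = N (diffset R' (R b))"
      by (simp add: N_dilate y flip: dilate_diffset)
    also have "\<dots> \<le> N (diffset (R b) (R b))"
      by (intro N_mono diffset_mono) (auto simp: R'_def)
    finally have 2: "N (diffset (dilate y R') (dilate y (R b))) \<le> L ^ 28 * n" using RR by linarith
    have 3: "N (diffset (dilate a P') (dilate y (R b))) \<le> L ^ (13 + 28 + 9) * n"
      by (rule ruzsa_triangle_scaled[OF 1 2 _ L1(1) n]) (use nR' y in \<open>simp add: N_dilate\<close>)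
    have "N (diffset (dilate a (P b)) (dilate a P')) = N (diffset (P b) P')"
      by (simp add: N_dilate nd[OF aA] flip: dilate_diffset)
    also have "\<dots> \<le> N (diffset (P b) (P b))"
      by (intro N_mono diffset_mono) (auto simp: P'_def)
    finally have 4: "N (diffset (dilate a (P b)) (dilate a P')) \<le> L ^ 28 * n" using PP by linarith
    have 5: "N (diffset (dilate a (P b)) (dilate y (R b))) \<le> L ^ (28 + (13 + 28 + 9) + 9) * n"
      by (rule ruzsa_triangle_scaled[OF 4 3 _ L1(1) n]) (use nP' nd[OF aA] in \<open>simp add: N_dilate\<close>)
    have "N (diffset (dilate a (P b)) (dilate b (P b))) \<le> L ^ (28 + (13 + 28 + 9) + 9 + 13 + 2) * n"
      by (rule ruzsa_triangle_scaled[OF 5 dRP _ L1(1) n]) (use nR y in \<open>simp add: N_dilate\<close>)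
    thus ?thesis by (simp add: N_diffset_commute)
  qed
  obtain b' where b': "(b * b') mod p = 1" using inverse_mod_ex[OF nd[OF b]] .
  have ndb': "\<not> p dvd b'" using b' by auto
  \<comment> \<open>Two more powers of L replace n by the size of \<open>P b\<close>.\<close>
  have toclose: "close (P b) (L ^ 104) x" if "N (diffset (P b) (dilate x (P b))) \<le> L ^ 102 * n" for x
  proof -
    have "L ^ 102 * n \<le> L ^ 102 * (L ^ 2 * N (P b))" using nP L1 by (intro mult_left_mono) auto
    thus ?thesis using that unfolding close_def by (simp flip: power_add mult.assoc)
  qed
  show ?thesis
  proof (rule that)
    show "P b \<subseteq> B" "card B \<le> L ^ 2 * card (P b)" using PR[OF b] by (auto simp: n_def)
    have "L ^ 28 * n \<le> L ^ 102 * n" using L1 n by (intro mult_right_mono power_increasing) auto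
    thus "close (P b) (L ^ 104) 1" using toclose[of 1] PP by simp
    \<comment> \<open>The close dilations are the quotients a / b, because dilation by b turns P -
      (a/b)P into bP - aP.\<close>
    let ?D = "(\<lambda>a. (a * b') mod p) ` A'"
    show "?D \<subseteq> {0..<p}" using p_pos by auto
    have "inj_on (\<lambda>a. (a * b') mod p) A'"
    proof (rule inj_onI)
      fix a c assume ac: "a \<in> A'" "c \<in> A'" "(a * b') mod p = (c * b') mod p"
      hence "a mod p = c mod p" using mult_mod_cancel[OF ndb', of a c] by (simp add: mult.commute)
      moreover have "a \<in> {1..<p}" "c \<in> {1..<p}" using ac A(1) by (auto simp: A'_def)
      ultimately show "a = c" by simp
    qed
    thus "card A \<le> L ^ 9 * card ?D" using cardA' by (simp add: card_image)
    fix x assume "x \<in> ?D"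
    then obtain a where a: "a \<in> A'" "x = (a * b') mod p" by auto
    have "N (diffset (P b) (dilate x (P b))) = N (dilate b (diffset (P b) (dilate x (P b))))"
      using nd[OF b] by (simp add: N_dilate)
    also have "\<dots> = N (diffset (dilate b (P b)) (dilate (b * x) (P b)))"
      by (simp add: dilate_diffset dilate_dilate)
    also have "\<dots> = N (diffset (dilate b (P b)) (dilate a (P b)))"
    proof (rule N_diffset_dilate_cong)
      have "(b * x) mod p = (a * ((b * b') mod p)) mod p"
        unfolding a(2) by (simp add: mod_simps mult_ac)
      thus "(b * x) mod p = a mod p" using b' by simp
    qed
    finally show "close (P b) (L ^ 104) x" using toclose key[OF a(1)] by simp
  qed
qed

text \<open>The set of close dilations has at least |A| / L^9 elements, so by \<open>big\<close> j
  rounds of generation reach every residue, with loss W = L^(104 * 438^j). In the energy dichotomy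
  for \<open>P\<close> the extra L^3 pays for a factor 2 or 4 and, in the first case, for passing
  from \<open>P\<close> to \<open>B\<close>.\<close>

lemma no_additive_structure:
  fixes L :: real
  assumes B: "B \<subseteq> {0..<p}" "B \<noteq> {}" and L: "6 \<le> L"
    and Lam: "finite Lam" "real (card Lam) \<le> L * card B"
    and A: "A \<subseteq> {1..<p}" and y: "\<not> p dvd y"
    and E: "\<And>a. a \<in> A \<Longrightarrow>
      (real (card B))\<^sup>2 \<le> L * card {(b, c). b \<in> B \<and> c \<in> B \<and> (a * b - y * c) mod p \<in> Lam}"
    and big: "p < (card A / L ^ 9) ^ (2 ^ j)"
  shows "card B \<le> L ^ (104 * 438 ^ j + 3) \<or> p \<le> L ^ (104 * 438 ^ j + 3) * card B"
proof -
  have L1: "1 \<le> L" "0 < L" using L by auto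
  have "A \<noteq> {}" using big p_pos by (auto simp: power_0_left)
  then obtain P D where P: "P \<subseteq> B" "card B \<le> L ^ 2 * card P" "close P (L ^ 104) 1"
    and D: "D \<subseteq> {0..<p}" "card A \<le> L ^ 9 * card D" "\<And>x. x \<in> D \<Longrightarrow> close P (L ^ 104) x"
    using many_close_dilations[OF B L Lam A _ y E] by metis
  have finB: "finite B" using B(1) finite_subset by blast
  have finP: "finite P" using P(1) finB finite_subset by blast
  have "card B > 0" using B finB by (simp add: card_gt_0_iff)
  hence "P \<noteq> {}" using P(2) by auto
  have "(card A / L ^ 9) ^ (2 ^ j) \<le> real (card D) ^ (2 ^ j)"
    using D(2) L1 by (intro power_mono) (auto simp: field_simps)
  hence pD: "p < real (card D) ^ (2 ^ j)" using big by linarith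
  have D2: "2 \<le> card D"
  proof (rule ccontr)
    assume "\<not> ?thesis"
    hence "real (card D) ^ (2 ^ j) \<le> 1" by (intro power_le_one) auto
    thus False using pD p_gt_1 by simp
  qed
  have "L \<le> L ^ 104" using L1 by (intro self_le_power) auto
  hence L3: "3 \<le> L ^ 104" using L by linarith
  define W where "W = L ^ (104 * 438 ^ j)"
  have W: "close P W x" for x
    using close_generate[OF finP \<open>P \<noteq> {}\<close> L3 P(3) D(1) D2 D(3) pD] by (simp add: W_def flip: power_mult)
  have W1: "1 \<le> W" using L1 by (simp add: W_def one_le_power)
  have WL: "L ^ (104 * 438 ^ j + 3) = W * L ^ 3" by (simp add: W_def power_add)
  have PB: "real (card P) \<le> card B" using P(1) finB by (auto intro: card_mono)
  have "card P \<le> 2 * W \<or> p - 1 \<le> 2 * W * card P"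
    using close_all_imp[of P W] P(1) B(1) \<open>P \<noteq> {}\<close> W W1 by auto
  thus ?thesis
  proof
    assume a: "card P \<le> 2 * W"
    have "card B \<le> L ^ 2 * (2 * W)"
      using P(2) a L1 by (meson mult_left_mono order_trans zero_le_power less_imp_le)
    also have "\<dots> \<le> L ^ 2 * (L * W)" using L W1 L1 by (intro mult_left_mono mult_right_mono) auto
    also have "\<dots> = L ^ (104 * 438 ^ j + 3)" unfolding WL by (simp add: numeral_eq_Suc)
    finally show ?thesis by blast
  next
    assume a: "p - 1 \<le> 2 * W * card P"
    have "2 \<le> real_of_int p" using p_gt_1 by simp
    hence "real_of_int p \<le> 2 * (real_of_int p - 1)" by (simp add: algebra_simps)
    also have "\<dots> \<le> 2 * (2 * W * card P)" using a by simp
    also have "\<dots> \<le> 4 * W * card B" using PB W1 by simp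
    also have "\<dots> \<le> L ^ 3 * W * card B"
    proof (intro mult_right_mono)
      have "L \<le> L ^ 3" using L1 by (intro self_le_power) auto
      thus "4 \<le> L ^ 3" using L by linarith
    qed (use W1 in auto)
    finally show ?thesis unfolding WL by (simp add: mult_ac)
  qed
qed

end

section \<open>Fourier analysis of product sets\<close>

text \<open>Products are listed with multiplicity, so an average over the list is an average over
  all tuples of factors and representations need not be counted.\<close>

primrec products :: "int list list \<Rightarrow> int list" where
  "products [] = [1]"
| "products (as # ass) = concat (map (\<lambda>a. map ((*) a) (products ass)) as)"

lemma sum_list_products:
  fixes g :: "int \<Rightarrow> 'a :: comm_monoid_add"
  shows "(\<Sum>x\<leftarrow>products (as # ass). g x) = (\<Sum>a\<leftarrow>as. \<Sum>x\<leftarrow>products ass. g (a * x))"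
  by (induction as) (simp_all add: o_def)

lemma length_products: "length (products (as # ass)) = length as * length (products ass)"
  by (induction as) simp_all

lemma products_single: "products [as] = as"
  by (induction as) simp_all

lemma products_nonempty: "(\<And>as. as \<in> set ass \<Longrightarrow> as \<noteq> []) \<Longrightarrow> products ass \<noteq> []"
  by (induction ass) (auto simp: ex_in_conv)

declare products.simps(2) [simp del]

context prime_modulus
begin

definition e :: "int \<Rightarrow> complex" where
  "e x = cis (2 * pi * x / p)"

lemma e_0 [simp]: "e 0 = 1"
  by (simp add: e_def)

lemma norm_e [simp]: "norm (e x) = 1"
  by (simp add: e_def)

lemma e_add: "e (x + y) = e x * e y"
  by (simp add: e_def cis_mult add_divide_distrib algebra_simps)

lemma e_minus: "e (- x) = cnj (e x)"
  by (simp add: e_def cis_cnj)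

lemma e_diff: "e (x - y) = e x * cnj (e y)"
  using e_add[of x "- y"] by (simp add: e_minus)

lemma e_eq_1_iff: "e x = 1 \<longleftrightarrow> p dvd x"
proof
  assume "e x = 1"
  hence "cos (2 * pi * x / p) = 1" by (metis e_def cis.simps(1) one_complex.simps(1))
  then obtain n :: int where "2 * pi * x / p = of_int n * 2 * pi" unfolding cos_one_2pi_int by blast
  hence "real_of_int x = n * p" using p_pos by (simp add: field_simps)
  hence "x = n * p" by (metis of_int_eq_iff of_int_mult)
  thus "p dvd x" by simp
next
  assume "p dvd x"
  then obtain n where "x = p * n" by blast
  hence "2 * pi * x / p = 2 * pi * n" using p_pos by simp
  thus "e x = 1" by (simp add: e_def cis_multiple_2pi)
qed

lemma e_cong: "x mod p = y mod p \<Longrightarrow> e x = e y"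
proof -
  assume "x mod p = y mod p"
  hence "e (x - y) = 1" by (simp add: e_eq_1_iff mod_eq_dvd_iff)
  thus "e x = e y" using e_add[of "x - y" y] by simp
qed

text \<open>Shifting t by one multiplies the sum by \<open>e x\<close>, which is different from 1
  unless p divides x.\<close>

lemma sum_e: "(\<Sum>t\<in>{0..<p}. e (t * x)) = (if p dvd x then of_int p else 0)"
proof (cases "p dvd x")
  case True
  hence "e (t * x) = 1" for t by (simp add: e_eq_1_iff)
  thus ?thesis using True p_pos by simp
next
  case False
  define S where "S = (\<Sum>t\<in>{0..<p}. e (t * x))"
  have "S = (\<Sum>t\<in>{0..<p}. e (((t + 1) mod p) * x))"
    unfolding S_def
  proof (rule sum.reindex_bij_witness[of _ "\<lambda>t. (t + 1) mod p" "\<lambda>t. (t - 1) mod p"])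
  qed (use p_pos in \<open>auto simp: mod_simps\<close>)
  also have "\<dots> = (\<Sum>t\<in>{0..<p}. e (t * x) * e x)"
  proof (rule sum.cong[OF refl])
    fix t
    have "e (((t + 1) mod p) * x) = e ((t + 1) * x)" by (rule e_cong) (simp add: mod_simps)
    thus "e (((t + 1) mod p) * x) = e (t * x) * e x" by (simp add: ring_distribs e_add)
  qed
  also have "\<dots> = S * e x" unfolding S_def by (rule sum_distrib_right[symmetric])
  finally have "S = S * e x" .
  hence "S = 0" using False e_eq_1_iff by simp
  thus ?thesis using False by (simp add: S_def)
qed

lemma parseval:
  assumes "S \<subseteq> {0..<p}"
  shows "(\<Sum>t\<in>{0..<p}. (norm (\<Sum>s\<in>S. e (t * s)))\<^sup>2) = p * card S"
proof -
  have fin: "finite S" using assms finite_subset by blast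
  have "complex_of_real (\<Sum>t\<in>{0..<p}. (norm (\<Sum>s\<in>S. e (t * s)))\<^sup>2)
      = (\<Sum>t\<in>{0..<p}. \<Sum>s\<in>S. \<Sum>u\<in>S. e (t * (s - u)))"
    by (simp add: complex_norm_square sum_product right_diff_distrib e_diff flip: of_real_power)
  also have "\<dots> = (\<Sum>s\<in>S. \<Sum>u\<in>S. \<Sum>t\<in>{0..<p}. e (t * (s - u)))"
    by (subst sum.swap, rule sum.cong[OF refl], rule sum.swap)
  also have "\<dots> = (\<Sum>s\<in>S. \<Sum>u\<in>S. if s = u then of_int p else 0)"
  proof (intro sum.cong refl)
    fix s u assume "s \<in> S" "u \<in> S"
    hence "p dvd s - u \<longleftrightarrow> s = u" using dvd_diff_residues assms by (metis diff_self dvd_0_right subsetD)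
    thus "(\<Sum>t\<in>{0..<p}. e (t * (s - u))) = (if s = u then of_int p else 0)" by (simp add: sum_e)
  qed
  also have "\<dots> = of_int p * of_nat (card S)" using fin by simp
  finally have "complex_of_real (\<Sum>t\<in>{0..<p}. (norm (\<Sum>s\<in>S. e (t * s)))\<^sup>2) = complex_of_real (p * card S)"
    by simp
  thus ?thesis by (simp only: of_real_eq_iff)
qed

section \<open>Normalised exponential sums and their large spectrum\<close>

definition expectation :: "int list \<Rightarrow> int \<Rightarrow> complex" where
  "expectation xs t = (\<Sum>k<length xs. e (t * xs ! k)) / length xs"

definition spectrum :: "int list \<Rightarrow> real \<Rightarrow> int set" where
  "spectrum xs c = {t \<in> {0..<p}. c \<le> norm (expectation xs t)}"

lemma finite_spectrum [simp]: "finite (spectrum xs c)"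
  by (rule finite_subset[of _ "{0..<p}"]) (auto simp: spectrum_def)

lemma expectation_sum_list: "expectation xs t = (\<Sum>x\<leftarrow>xs. e (t * x)) / length xs"
  by (simp add: expectation_def sum_list_sum_nth atLeast0LessThan)

lemma expectation_distinct:
  "distinct xs \<Longrightarrow> expectation xs t = (\<Sum>x\<in>set xs. e (t * x)) / length xs"
  by (simp add: expectation_sum_list sum_list_distinct_conv_sum_set)

lemma norm_expectation_le: "norm (expectation xs t) \<le> 1"
proof -
  have "norm (\<Sum>k<length xs. e (t * xs ! k)) \<le> (\<Sum>k<length xs. 1)"
    by (rule sum_norm_le) simp
  thus ?thesis by (simp add: expectation_def norm_divide divide_le_eq)
qed

lemma expectation_cong: "t mod p = u mod p \<Longrightarrow> expectation xs t = expectation xs u"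
  unfolding expectation_def
  by (intro arg_cong2[where f = divide] sum.cong refl e_cong mod_mult_cong)

lemma expectation_products:
  assumes "distinct as"
  shows "expectation (products (as # ass)) t = (\<Sum>a\<in>set as. expectation (products ass) (t * a)) / length as"
proof -
  have "(\<Sum>x\<leftarrow>products (as # ass). e (t * x)) = (\<Sum>a\<in>set as. \<Sum>x\<leftarrow>products ass. e (t * a * x))"
    using assms by (simp only: sum_list_products sum_list_distinct_conv_sum_set mult.assoc)
  thus ?thesis
    by (simp add: expectation_sum_list length_products sum_divide_distrib[symmetric] mult.commute)
qed

text \<open>Each frequency of the spectrum contributes at least (m / K)^2 to the Parseval sum, whose
  total is p m.\<close>

lemma card_spectrum_distinct:
  fixes K :: real
  assumes "distinct as" "set as \<subseteq> {0..<p}" "as \<noteq> []" "0 < K"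
  shows "card (spectrum as (1 / K)) * length as \<le> K\<^sup>2 * p"
proof -
  define m where "m = real (length as)"
  have m: "m > 0" using assms by (simp add: m_def)
  have "card (spectrum as (1 / K)) * (m / K)\<^sup>2 \<le> (\<Sum>t\<in>spectrum as (1 / K). (norm (\<Sum>s\<in>set as. e (t * s)))\<^sup>2)"
  proof (rule sum_bounded_below)
    fix t assume "t \<in> spectrum as (1 / K)"
    hence "1 / K \<le> norm (\<Sum>s\<in>set as. e (t * s)) / m"
      by (simp add: spectrum_def expectation_distinct assms(1) norm_divide m_def)
    hence "m / K \<le> norm (\<Sum>s\<in>set as. e (t * s))" using m assms(4) by (simp add: field_simps)
    thus "(m / K)\<^sup>2 \<le> (norm (\<Sum>s\<in>set as. e (t * s)))\<^sup>2" using m assms(4) by (intro power_mono) auto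
  qed
  also have "\<dots> \<le> (\<Sum>t\<in>{0..<p}. (norm (\<Sum>s\<in>set as. e (t * s)))\<^sup>2)"
    by (rule sum_mono2) (auto simp: spectrum_def)
  also have "\<dots> = p * m" using parseval[OF assms(2)] by (simp add: m_def distinct_card assms(1))
  finally have "m * (card (spectrum as (1 / K)) * m) \<le> m * (K\<^sup>2 * p)"
    using assms(4) by (simp add: field_simps power2_eq_square)
  thus ?thesis using m by (simp add: m_def)
qed

text \<open>Positive definiteness of \<open>expectation xs\<close>, the Fourier transform of a probability measure.\<close>

lemma norm_sum_expectation_le:
  assumes "xs \<noteq> []" "finite I" "\<And>i. i \<in> I \<Longrightarrow> norm (c i) \<le> 1"
  shows "(norm (\<Sum>i\<in>I. c i * expectation xs (t i)))\<^sup>2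
    \<le> (\<Sum>i\<in>I. \<Sum>j\<in>I. norm (expectation xs (t i - t j)))"
proof -
  define n where "n = length xs"
  have n: "real n > 0" using assms by (simp add: n_def)
  \<comment> \<open>Cauchy-Schwarz over the positions k of the list; expanding |h k|^2 then averages
    \<open>e\<close> at the differences t i - t j.\<close>
  define h where "h k = (\<Sum>i\<in>I. c i * e (t i * xs ! k))" for k
  have "(\<Sum>i\<in>I. c i * expectation xs (t i)) = (\<Sum>i\<in>I. \<Sum>k<n. c i * e (t i * xs ! k)) / n"
    by (simp add: expectation_def n_def sum_divide_distrib[symmetric] sum_distrib_left)
  also have "\<dots> = (\<Sum>k<n. h k) / n" unfolding h_def by (subst sum.swap) (rule refl)
  finally have "norm (\<Sum>i\<in>I. c i * expectation xs (t i)) = norm (\<Sum>k<n. h k) / n"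
    by (simp add: norm_divide)
  also have "\<dots> \<le> (\<Sum>k<n. norm (h k)) / n" by (intro divide_right_mono norm_sum) simp
  finally have "(norm (\<Sum>i\<in>I. c i * expectation xs (t i)))\<^sup>2 \<le> ((\<Sum>k<n. norm (h k)) / n)\<^sup>2"
    by (intro power_mono) auto
  also have "\<dots> = (\<Sum>k<n. norm (h k))\<^sup>2 / n\<^sup>2" by (simp add: power_divide)
  also have "\<dots> \<le> (n * (\<Sum>k<n. (norm (h k))\<^sup>2)) / n\<^sup>2"
    using sum_squared_le_card_mult[of "{..<n}" "\<lambda>k. norm (h k)"] by (intro divide_right_mono) auto
  also have "\<dots> = (\<Sum>k<n. (norm (h k))\<^sup>2) / n" using n by (simp add: power2_eq_square)
  finally have 1: "(norm (\<Sum>i\<in>I. c i * expectation xs (t i)))\<^sup>2 \<le> (\<Sum>k<n. (norm (h k))\<^sup>2) / n" .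
  have "complex_of_real (\<Sum>k<n. (norm (h k))\<^sup>2) = (\<Sum>k<n. \<Sum>i\<in>I. \<Sum>j\<in>I. c i * cnj (c j) * e ((t i - t j) * xs ! k))"
    unfolding of_real_sum
  proof (rule sum.cong[OF refl])
    fix k
    have "e ((u - v) * x) = e (u * x) * cnj (e (v * x))" for u v x
      by (simp add: left_diff_distrib e_diff)
    hence summand: "c i * e (t i * xs ! k) * cnj (c j * e (t j * xs ! k))
        = c i * cnj (c j) * e ((t i - t j) * xs ! k)" for i j by simp
    have "complex_of_real ((norm (h k))\<^sup>2) = h k * cnj (h k)" by (rule complex_norm_square)
    also have "\<dots> = (\<Sum>i\<in>I. \<Sum>j\<in>I. c i * e (t i * xs ! k) * cnj (c j * e (t j * xs ! k)))"
      unfolding h_def cnj_sum sum_product ..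
    finally show "complex_of_real ((norm (h k))\<^sup>2)
        = (\<Sum>i\<in>I. \<Sum>j\<in>I. c i * cnj (c j) * e ((t i - t j) * xs ! k))"
      unfolding summand .
  qed
  also have "\<dots> = (\<Sum>i\<in>I. \<Sum>j\<in>I. \<Sum>k<n. c i * cnj (c j) * e ((t i - t j) * xs ! k))"
    by (subst sum.swap, rule sum.cong[OF refl], rule sum.swap)
  also have "\<dots> = (\<Sum>i\<in>I. \<Sum>j\<in>I. n * (c i * cnj (c j) * expectation xs (t i - t j)))"
  proof (intro sum.cong refl)
    fix i j
    have eq: "(\<Sum>k<n. e ((t i - t j) * xs ! k)) = n * expectation xs (t i - t j)"
      using assms(1) by (simp add: expectation_def n_def)
    show "(\<Sum>k<n. c i * cnj (c j) * e ((t i - t j) * xs ! k)) = n * (c i * cnj (c j) * expectation xs (t i - t j))"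
      unfolding sum_distrib_left[symmetric] eq by (rule mult.left_commute)
  qed
  finally have "norm (complex_of_real (\<Sum>k<n. (norm (h k))\<^sup>2))
      = norm (\<Sum>i\<in>I. \<Sum>j\<in>I. n * (c i * cnj (c j) * expectation xs (t i - t j)))" by (rule arg_cong)
  moreover have "0 \<le> (\<Sum>k<n. (norm (h k))\<^sup>2)" by (simp add: sum_nonneg)
  ultimately have "(\<Sum>k<n. (norm (h k))\<^sup>2)
      = norm (\<Sum>i\<in>I. \<Sum>j\<in>I. n * (c i * cnj (c j) * expectation xs (t i - t j)))"
    unfolding norm_of_real by linarith
  also have "\<dots> \<le> (\<Sum>i\<in>I. \<Sum>j\<in>I. n * norm (expectation xs (t i - t j)))"
  proof (intro sum_norm_le)
    fix i j assume "i \<in> I" "j \<in> I"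
    hence "norm (c i) * norm (c j) \<le> 1 * 1" using assms(3) by (intro mult_mono) auto
    thus "norm (n * (c i * cnj (c j) * expectation xs (t i - t j))) \<le> n * norm (expectation xs (t i - t j))"
      by (simp add: norm_mult mult_left_mono mult_left_le_one_le)
  qed
  also have "\<dots> = n * (\<Sum>i\<in>I. \<Sum>j\<in>I. norm (expectation xs (t i - t j)))"
    by (simp add: sum_distrib_left)
  finally have "(\<Sum>k<n. (norm (h k))\<^sup>2) / n \<le> (\<Sum>i\<in>I. \<Sum>j\<in>I. norm (expectation xs (t i - t j)))"
    using n by (simp add: field_simps)
  thus ?thesis using 1 by linarith
qed

text \<open>Phases align the coefficients at B, so the weighted sum of f(ab) over all a and b is at
  least |as| |B| / K. Squaring by positive definiteness brings in the frequencies ab - yc, and the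
  best y is at least as good as the average one.\<close>

lemma spectrum_pairs:
  assumes "distinct as" "as \<noteq> []" "products ass \<noteq> []" "finite B" "0 < K"
    and B: "\<And>t. t \<in> B \<Longrightarrow> 1 / K \<le> norm (expectation (products (as # ass)) t)"
  shows "\<exists>y\<in>set as. length as * (real (card B))\<^sup>2 / K\<^sup>2 \<le>
    (\<Sum>a\<in>set as. \<Sum>(b, c)\<in>B \<times> B. norm (expectation (products ass) (a * b - y * c)))"
proof -
  let ?f = "expectation (products ass)" and ?g = "expectation (products (as # ass))"
  define m n where "m = real (length as)" and "n = real (card B)"
  have m: "m > 0" using assms by (simp add: m_def)
  let ?I = "set as \<times> B"
  have "(\<Sum>(a, b)\<in>?I. sgn (cnj (?g b)) * ?f (a * b)) = (\<Sum>b\<in>B. \<Sum>a\<in>set as. sgn (cnj (?g b)) * ?f (a * b))"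
    by (subst sum.swap) (simp add: sum.cartesian_product)
  also have "\<dots> = (\<Sum>b\<in>B. sgn (cnj (?g b)) * (m * ?g b))"
  proof (rule sum.cong[OF refl])
    fix b
    have "m * ?g b = (\<Sum>a\<in>set as. ?f (a * b))"
      using m by (simp add: expectation_products[OF assms(1)] m_def mult.commute)
    thus "(\<Sum>a\<in>set as. sgn (cnj (?g b)) * ?f (a * b)) = sgn (cnj (?g b)) * (m * ?g b)"
      by (simp only: sum_distrib_left)
  qed
  also have "\<dots> = (\<Sum>b\<in>B. complex_of_real (m * norm (?g b)))"
  proof (rule sum.cong[OF refl])
    fix b
    have "sgn (cnj z) * z = norm z" for z :: complex
      by (cases "z = 0") (simp_all add: sgn_eq mult.commute complex_norm_square[symmetric] power2_eq_square)
    thus "sgn (cnj (?g b)) * (m * ?g b) = complex_of_real (m * norm (?g b))"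
      by (metis mult.left_commute of_real_mult)
  qed
  finally have "norm (\<Sum>(a, b)\<in>?I. sgn (cnj (?g b)) * ?f (a * b)) = \<bar>\<Sum>b\<in>B. m * norm (?g b)\<bar>"
    by (metis of_real_sum norm_of_real)
  moreover have "n * (m * (1 / K)) \<le> (\<Sum>b\<in>B. m * norm (?g b))"
    unfolding n_def using B m by (intro sum_bounded_below mult_left_mono) auto
  ultimately have "(n * (m * (1 / K)))\<^sup>2 \<le> (norm (\<Sum>(a, b)\<in>?I. sgn (cnj (?g b)) * ?f (a * b)))\<^sup>2"
    using m assms(5) by (intro power_mono) (auto simp: n_def)
  also have "\<dots> \<le> (\<Sum>i\<in>?I. \<Sum>j\<in>?I. norm (?f (fst i * snd i - fst j * snd j)))"
    unfolding case_prod_beta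
    by (rule norm_sum_expectation_le) (use assms in \<open>auto simp: norm_sgn\<close>)
  also have "\<dots> = (\<Sum>a\<in>set as. \<Sum>b\<in>B. \<Sum>y\<in>set as. \<Sum>c\<in>B. norm (?f (a * b - y * c)))"
  proof -
    have "(\<Sum>i\<in>?I. G i) = (\<Sum>a\<in>set as. \<Sum>b\<in>B. G (a, b))" for G :: "int \<times> int \<Rightarrow> real"
      by (simp add: sum.cartesian_product)
    thus ?thesis by (simp only: fst_conv snd_conv)
  qed
  also have "\<dots> = (\<Sum>a\<in>set as. \<Sum>y\<in>set as. \<Sum>b\<in>B. \<Sum>c\<in>B. norm (?f (a * b - y * c)))"
    by (intro sum.cong refl sum.swap)
  also have "\<dots> = (\<Sum>y\<in>set as. \<Sum>a\<in>set as. \<Sum>b\<in>B. \<Sum>c\<in>B. norm (?f (a * b - y * c)))"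
    by (rule sum.swap)
  also have "\<dots> = (\<Sum>y\<in>set as. \<Sum>a\<in>set as. \<Sum>(b, c)\<in>B \<times> B. norm (?f (a * b - y * c)))"
    by (simp add: sum.cartesian_product)
  finally have S: "m * (m * n\<^sup>2 / K\<^sup>2) \<le> (\<Sum>y\<in>set as. \<Sum>a\<in>set as. \<Sum>(b, c)\<in>B \<times> B. norm (?f (a * b - y * c)))"
    by (simp add: power_mult_distrib power_divide power2_eq_square mult_ac)
  show ?thesis
  proof (rule ccontr)
    assume "\<not> ?thesis"
    hence "(\<Sum>y\<in>set as. \<Sum>a\<in>set as. \<Sum>(b, c)\<in>B \<times> B. norm (?f (a * b - y * c))) < (\<Sum>y\<in>set as. m * n\<^sup>2 / K\<^sup>2)"
      using assms(2) by (intro sum_strict_mono) (auto simp: not_le m_def n_def)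
    thus False using S by (simp add: m_def distinct_card assms(1))
  qed
qed

text \<open>Without growth, the spectrum of the shorter product can play the role of
  \<open>Lam\<close>. For the fixed y the average of |f(ab - yc)| is at least 1/K^2; selecting good
  a and then good pairs (b, c) halves this twice, whence the level 1/(4K^2). Since |A| \<ge> |as| /
  (2K^2) \<ge> |as| / L, the bound needs L^10 instead of L^9.\<close>

lemma spectrum_growth:
  fixes K L :: real
  assumes as: "distinct as" "set as \<subseteq> {1..<p}" and ass: "products ass \<noteq> []"
    and K: "1 \<le> K" and L: "6 \<le> L" "4 * K\<^sup>2 \<le> L"
    and B: "B \<subseteq> spectrum (products (as # ass)) (1 / K)" "B \<noteq> {}"
    and big: "p < (length as / L ^ 10) ^ (2 ^ j)"
    and small: "card (spectrum (products ass) (1 / (4 * K\<^sup>2))) \<le> L * card B"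
  shows "card B \<le> L ^ (104 * 438 ^ j + 3) \<or> p \<le> L ^ (104 * 438 ^ j + 3) * card B"
proof -
  let ?f = "expectation (products ass)"
  have L0: "0 < L" using L by simp
  have finB: "finite B" using B(1) finite_subset finite_spectrum by blast
  define n where "n = real (card B)"
  have n: "n > 0" using B finB by (simp add: n_def card_gt_0_iff)
  have "as \<noteq> []" using big p_pos by (auto simp: power_0_left)
  then obtain y where y: "y \<in> set as" and sum: "length as * n\<^sup>2 / K\<^sup>2 \<le>
      (\<Sum>a\<in>set as. \<Sum>(b, c)\<in>B \<times> B. norm (?f (a * b - y * c)))"
    using spectrum_pairs[of as ass B K] as(1) ass finB K B(1)
    unfolding n_def spectrum_def by auto
  define s where "s a = (\<Sum>(b, c)\<in>B \<times> B. norm (?f (a * b - y * c)))" for a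
  have cBB: "real (card (B \<times> B)) = n\<^sup>2" by (simp add: n_def card_cartesian_product power2_eq_square)
  define A where "A = {a \<in> set as. (1 / K\<^sup>2) / 2 * n\<^sup>2 \<le> s a}"
  have "(1 / K\<^sup>2) / 2 * card (set as) \<le> card A"
    unfolding A_def
  proof (rule card_popular)
    fix a
    have "s a \<le> real (card (B \<times> B)) * 1"
      unfolding s_def by (rule sum_bounded_above) (auto simp: norm_expectation_le)
    thus "s a \<le> n\<^sup>2" using cBB by simp
  qed (use n sum in \<open>auto simp: s_def distinct_card as(1) mult_ac\<close>)
  hence "length as \<le> 2 * K\<^sup>2 * card A" using K by (simp add: distinct_card as(1) field_simps)
  also have "\<dots> \<le> L * card A" using L by (intro mult_right_mono) auto
  finally have "length as / L ^ 10 \<le> card A / L ^ 9"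
    using L0 by (simp add: field_simps numeral_eq_Suc)
  hence "(length as / L ^ 10) ^ (2 ^ j) \<le> (card A / L ^ 9) ^ (2 ^ j)" using L0 by (intro power_mono) auto
  hence big': "p < (card A / L ^ 9) ^ (2 ^ j)" using big by linarith
  have E: "(real (card B))\<^sup>2 \<le> L * card {(b, c). b \<in> B \<and> c \<in> B \<and>
      (a * b - y * c) mod p \<in> spectrum (products ass) (1 / (4 * K\<^sup>2))}" if "a \<in> A" for a
  proof -
    let ?g = "\<lambda>(b, c). norm (?f (a * b - y * c))"
    have "(1 / (2 * K\<^sup>2)) / 2 * card (B \<times> B) \<le> card {q \<in> B \<times> B. (1 / (2 * K\<^sup>2)) / 2 * 1 \<le> ?g q}"
    proof (rule card_popular)
      show "1 / (2 * K\<^sup>2) * 1 * card (B \<times> B) \<le> sum ?g (B \<times> B)"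
        using that unfolding cBB A_def s_def by simp
    qed (use finB in \<open>auto simp: norm_expectation_le\<close>)
    also have "{q \<in> B \<times> B. (1 / (2 * K\<^sup>2)) / 2 * 1 \<le> ?g q} = {(b, c). b \<in> B \<and> c \<in> B \<and>
      (a * b - y * c) mod p \<in> spectrum (products ass) (1 / (4 * K\<^sup>2))}"
    proof -
      have "?f (t mod p) = ?f t" for t by (rule expectation_cong) simp
      thus ?thesis using p_pos by (auto simp: spectrum_def)
    qed
    finally have "n\<^sup>2 \<le> 4 * K\<^sup>2 * card {(b, c). b \<in> B \<and> c \<in> B \<and>
      (a * b - y * c) mod p \<in> spectrum (products ass) (1 / (4 * K\<^sup>2))}"
      using K unfolding cBB by (simp add: field_simps)
    also have "\<dots> \<le> L * card {(b, c). b \<in> B \<and> c \<in> B \<and>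
      (a * b - y * c) mod p \<in> spectrum (products ass) (1 / (4 * K\<^sup>2))}"
      using L by (intro mult_right_mono) auto
    finally show ?thesis by (simp add: n_def)
  qed
  show ?thesis
  proof (rule no_additive_structure[OF _ B(2) L(1) finite_spectrum small _ _ E big'])
    show "B \<subseteq> {0..<p}" using B(1) by (auto simp: spectrum_def)
    show "A \<subseteq> {1..<p}" using as(2) by (auto simp: A_def)
    show "\<not> p dvd y" using as(2) y zdvd_not_zless by auto
  qed
qed

end

section \<open>Growth of the spectrum\<close>

context prime_modulus
begin

text \<open>The spectrum grows by a factor of \<open>L\<close> with every block that is removed, at the cost of
  replacing the level \<open>1 / K\<close> by \<open>1 / (4 K\<^sup>2)\<close>; Parseval bounds it for the last block.\<close>

lemma card_spectrum_products_le:
  fixes K L :: real and T U :: nat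
  assumes L: "6 \<le> L" and T: "1 \<le> T" "T \<le> U" "L ^ (104 * 438 ^ j + 3) < T"
    and U: "L ^ (104 * 438 ^ j + 3) * U < p"
    and "\<And>as. as \<in> set ass \<Longrightarrow> distinct as \<and> set as \<subseteq> {1..<p} \<and> L * p \<le> length as * U \<and>
      p < (length as / L ^ 10) ^ (2 ^ j)"
    and "ass \<noteq> []" "1 \<le> K" "(4 * K) ^ (2 ^ length ass) \<le> L"
    and "T \<le> card (spectrum (products ass) (1 / K))"
  shows "card (spectrum (products ass) (1 / K)) * L ^ (length ass - 1) \<le> U"
  using assms(6-)
proof (induction ass arbitrary: K)
  case Nil
  thus ?case by simp
next
  case (Cons as ass)
  note K = Cons.prems(3)
  have as: "distinct as" "set as \<subseteq> {1..<p}" "L * p \<le> length as * U" "p < (length as / L ^ 10) ^ (2 ^ j)"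
    using Cons.prems(1)[of as] by auto
  have ass_nonempty: "bs \<noteq> []" if "bs \<in> set (as # ass)" for bs
    using Cons.prems(1)[OF that] p_pos by (auto simp: power_0_left)
  have level: "(4 * K)\<^sup>2 \<le> L"
  proof -
    have "(4 * K)\<^sup>2 \<le> (4 * K) ^ (2 ^ length (as # ass))"
      using K by (intro power_increasing) auto
    thus ?thesis using Cons.prems(4) by linarith
  qed
  show ?case
  proof (cases "ass = []")
    case True
    have "card (spectrum as (1 / K)) * length as \<le> K\<^sup>2 * p"
      by (rule card_spectrum_distinct) (use as(1,2) ass_nonempty K in auto)
    also have "\<dots> \<le> L * p"
    proof (rule mult_right_mono)
      have "K\<^sup>2 \<le> (4 * K)\<^sup>2" using K by (intro power_mono) auto
      thus "K\<^sup>2 \<le> L" using level by linarith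
    qed (use p_pos in auto)
    also note as(3)
    finally have "length as * card (spectrum as (1 / K)) \<le> length as * U"
      by (simp add: mult.commute flip: of_nat_mult)
    hence "card (spectrum as (1 / K)) \<le> U" using ass_nonempty[of as] by simp
    thus ?thesis using True by (simp add: products_single)
  next
    case False
    let ?B = "spectrum (products (as # ass)) (1 / K)"
    let ?B' = "spectrum (products ass) (1 / (4 * K\<^sup>2))"
    \<comment> \<open>The thresholds \<open>T\<close> and \<open>U\<close> are placed so that a set
      of intermediate size satisfies neither alternative of \<open>spectrum_growth\<close>.\<close>
    have grow: "L * card B < card ?B'" if B: "B \<subseteq> ?B" "T \<le> card B" "card B \<le> U" for B
    proof (rule ccontr)
      assume "\<not> ?thesis"
      hence small: "card ?B' \<le> L * card B" by simp
      have "card B \<le> L ^ (104 * 438 ^ j + 3) \<or> p \<le> L ^ (104 * 438 ^ j + 3) * card B"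
      proof (rule spectrum_growth[OF as(1,2) _ K L _ B(1) _ as(4) small])
        show "products ass \<noteq> []" using ass_nonempty by (intro products_nonempty) auto
        have "4 * K\<^sup>2 \<le> (4 * K)\<^sup>2" by (simp add: power_mult_distrib)
        thus "4 * K\<^sup>2 \<le> L" using level by linarith
        show "B \<noteq> {}" using B(2) T(1) by auto
      qed
      moreover have "L ^ (104 * 438 ^ j + 3) * card B \<le> L ^ (104 * 438 ^ j + 3) * U"
        using B(3) L by (intro mult_left_mono) auto
      moreover have "real T \<le> card B" using B(2) by simp
      ultimately show False using T(3) U by linarith
    qed
    have IH: "card ?B' * L ^ (length ass - 1) \<le> U" if "T \<le> card ?B'"
    proof (rule Cons.IH)
      have "1 \<le> K\<^sup>2" using K by simp
      thus "1 \<le> 4 * K\<^sup>2" by linarith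
      \<comment> \<open>Replacing K by 4K^2 squares 4K while the exponent 2^(number of blocks) is
        halved, so the level condition is the same for the shorter list.\<close>
      have "4 * (4 * K\<^sup>2) = (4 * K)\<^sup>2" by (simp add: power_mult_distrib)
      hence "(4 * (4 * K\<^sup>2)) ^ (2 ^ length ass) = ((4 * K)\<^sup>2) ^ (2 ^ length ass)" by (rule arg_cong)
      also have "\<dots> = (4 * K) ^ (2 ^ length (as # ass))"
        by (simp only: power_mult[symmetric] length_Cons power_Suc)
      finally show "(4 * (4 * K\<^sup>2)) ^ (2 ^ length ass) \<le> L" using Cons.prems(4) by simp
    qed (use Cons.prems(1) False that in auto)
    have TB': "T \<le> card ?B'" if "T \<le> m" "L * m < card ?B'" for m :: nat
    proof -
      have "1 * real m \<le> L * m" using L by (intro mult_right_mono) auto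
      hence "real m \<le> card ?B'" using that(2) by linarith
      thus ?thesis using that(1) by simp
    qed
    have L1: "1 \<le> L ^ (length ass - 1)" using L by (simp add: one_le_power)
    \<comment> \<open>If the spectrum had more than \<open>U\<close> elements, \<open>grow\<close>
      could not be applied to it directly; a subset of exactly \<open>U\<close> elements already
      makes the next spectrum too large for the induction hypothesis.\<close>
    have BU: "card ?B \<le> U"
    proof (rule ccontr)
      assume "\<not> ?thesis"
      then obtain B where B: "B \<subseteq> ?B" "card B = U" by (metis nat_le_linear obtain_subset_with_card_n)
      have LU: "L * U < card ?B'" using grow[OF B(1)] B(2) T(2) by simp
      moreover have "real (card ?B') * 1 \<le> card ?B' * L ^ (length ass - 1)"
        using L1 by (intro mult_left_mono) auto
      moreover have "1 * real U \<le> L * U" using L by (intro mult_right_mono) auto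
      ultimately show False using LU IH[OF TB'[OF T(2) LU]] by linarith
    qed
    have g: "L * card ?B < card ?B'" using grow[OF subset_refl Cons.prems(5) BU] .
    have "card ?B * L ^ (length (as # ass) - 1) = (L * card ?B) * L ^ (length ass - 1)"
      using False by (cases ass) auto
    also have "\<dots> \<le> card ?B' * L ^ (length ass - 1)" using g L by (intro mult_right_mono) auto
    also have "\<dots> \<le> U" using IH TB'[OF Cons.prems(5) g] by simp
    finally show ?thesis .
  qed
qed

text \<open>A coefficient of size 1/K at t forces coefficients of size 1/(2K) at t a for a
  proportion 1/(2K) of the a in \<open>as\<close>, which are at least T distinct frequencies. The
  spectrum bound then yields L^(k - 1) \<le> U < p for the k lists in \<open>ass\<close>, against
  \<open>k\<close>. The 8K is 4 times the new 2K.\<close>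

lemma norm_expectation_products_less:
  fixes K L :: real and T U :: nat
  assumes L: "6 \<le> L" and T: "1 \<le> T" "T \<le> U" "L ^ (104 * 438 ^ j + 3) < T"
    and U: "L ^ (104 * 438 ^ j + 3) * U < p"
    and ass: "\<And>as. as \<in> set ass \<Longrightarrow> distinct as \<and> set as \<subseteq> {1..<p} \<and> L * p \<le> length as * U \<and>
      p < (length as / L ^ 10) ^ (2 ^ j)" "ass \<noteq> []"
    and as: "distinct as" "set as \<subseteq> {1..<p}" "2 * K * T \<le> length as"
    and K: "1 \<le> K" "(8 * K) ^ (2 ^ length ass) \<le> L" and k: "p \<le> L ^ (length ass - 1)"
    and t: "\<not> p dvd t"
  shows "norm (expectation (products (as # ass)) t) < 1 / K"
proof (rule ccontr)
  assume "\<not> ?thesis"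
  hence ge: "1 / K \<le> norm (expectation (products (as # ass)) t)" by simp
  let ?f = "\<lambda>a. expectation (products ass) (t * a)"
  let ?A = "{a \<in> set as. 1 / K / 2 * 1 \<le> norm (?f a)}"
  have "2 * K * T > 0" using K T by simp
  hence m: "real (length as) > 0" using as(3) by linarith
  have "1 / K / 2 * card (set as) \<le> card ?A"
  proof (rule card_popular)
    have "1 / K * length as \<le> norm (expectation (products (as # ass)) t) * length as"
      using ge by (intro mult_right_mono) auto
    also have "\<dots> = norm (\<Sum>a\<in>set as. ?f a)"
      using m by (simp add: expectation_products as(1) norm_divide)
    also have "\<dots> \<le> (\<Sum>a\<in>set as. norm (?f a))" by (rule norm_sum)
    finally show "1 / K * 1 * card (set as) \<le> (\<Sum>a\<in>set as. norm (?f a))"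
      by (simp add: distinct_card as(1))
  qed (use K in \<open>auto simp: norm_expectation_le\<close>)
  moreover have "T \<le> 1 / K / 2 * card (set as)"
    using as(3) K by (simp add: distinct_card as(1) field_simps)
  ultimately have "T \<le> card ?A" by linarith
  also have "\<dots> \<le> card (spectrum (products ass) (1 / (2 * K)))"
  proof (rule card_inj_on_le)
    show "inj_on (\<lambda>a. (t * a) mod p) ?A"
    proof (rule inj_onI)
      fix a b assume ab: "a \<in> ?A" "b \<in> ?A" "(t * a) mod p = (t * b) mod p"
      hence "a mod p = b mod p" using mult_mod_cancel[OF t] by blast
      moreover have "a \<in> {1..<p}" "b \<in> {1..<p}" using ab as(2) by auto
      ultimately show "a = b" by simp
    qed
    have "expectation xs (u mod p) = expectation xs u" for xs u by (rule expectation_cong) simp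
    thus "(\<lambda>a. (t * a) mod p) ` ?A \<subseteq> spectrum (products ass) (1 / (2 * K))"
      using p_pos by (auto simp: spectrum_def)
  qed simp
  finally have TS: "T \<le> card (spectrum (products ass) (1 / (2 * K)))" .
  have "card (spectrum (products ass) (1 / (2 * K))) * L ^ (length ass - 1) \<le> U"
    by (rule card_spectrum_products_le[OF L T U ass]) (use K TS in auto)
  moreover have "1 * L ^ (length ass - 1) \<le> card (spectrum (products ass) (1 / (2 * K))) * L ^ (length ass - 1)"
    using TS T(1) L by (intro mult_right_mono) auto
  moreover have "1 * real U \<le> L ^ (104 * 438 ^ j + 3) * U"
    using L by (intro mult_right_mono) (auto simp: one_le_power)
  ultimately show False using U k by linarith
qed

text \<open>The weight is the convolution of an interval of length M with itself, so its Fourier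
  coefficients are squares whose absolute values add up by Parseval to p M. The main term M^2 at
  frequency 0 beats M/p times the rest.\<close>

lemma interval_hit:
  assumes xs: "xs \<noteq> []" and a0: "\<not> p dvd a0" and M: "1 \<le> M" "int M \<le> p"
    and small: "\<And>t. \<not> p dvd t \<Longrightarrow> norm (expectation xs t) \<le> M / p"
  shows "\<exists>x\<in>set xs. \<exists>i<M. \<exists>j<M. (a0 * x) mod p = (b + int i + int j) mod p"
proof (rule ccontr)
  assume none: "\<not> ?thesis"
  define n where "n = length xs"
  have n: "real n > 0" using xs by (simp add: n_def)
  let ?S = "{0..<int M}"
  define G where "G t = (\<Sum>s\<in>?S. e (t * s))" for t
  \<comment> \<open>Summed over t, n \<open>H t\<close> is p times the number of solutions of a0 x =
    b + i + j modulo p, which is 0 by assumption.\<close>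
  define H where "H t = expectation xs (t * a0) * (cnj (e (t * b)) * (cnj (G t) * cnj (G t)))" for t
  have "n * H t = (\<Sum>k<n. \<Sum>i\<in>?S. \<Sum>j\<in>?S. e (t * (a0 * xs ! k - (b + i + j))))" for t
  proof -
    have summand: "e (t * a0 * xs ! k) * (cnj (e (t * b)) * (cnj (e (t * i)) * cnj (e (t * j))))
        = e (t * (a0 * xs ! k - (b + i + j)))" for k i j
    proof -
      have "t * (a0 * xs ! k - (b + i + j)) = t * a0 * xs ! k - (t * b + (t * i + t * j))"
        by (simp add: algebra_simps)
      thus ?thesis by (simp add: e_diff e_add)
    qed
    have "n * H t = (\<Sum>k<n. e (t * a0 * xs ! k)) * (cnj (e (t * b)) * (cnj (G t) * cnj (G t)))"
      using n by (simp add: H_def expectation_def n_def)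
    also have "\<dots> = (\<Sum>k<n. e (t * a0 * xs ! k) * (cnj (e (t * b)) * (cnj (G t) * cnj (G t))))"
      by (rule sum_distrib_right)
    also have "\<dots> = (\<Sum>k<n. \<Sum>i\<in>?S. \<Sum>j\<in>?S. e (t * a0 * xs ! k) *
        (cnj (e (t * b)) * (cnj (e (t * i)) * cnj (e (t * j)))))"
      unfolding G_def cnj_sum sum_product by (simp only: sum_distrib_left)
    finally show ?thesis unfolding summand .
  qed
  hence "n * (\<Sum>t\<in>{0..<p}. H t)
      = (\<Sum>t\<in>{0..<p}. \<Sum>k<n. \<Sum>i\<in>?S. \<Sum>j\<in>?S. e (t * (a0 * xs ! k - (b + i + j))))"
    by (simp add: sum_distrib_left)
  also have "\<dots> = (\<Sum>k<n. \<Sum>i\<in>?S. \<Sum>j\<in>?S. \<Sum>t\<in>{0..<p}. e (t * (a0 * xs ! k - (b + i + j))))"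
    by (subst sum.swap, rule sum.cong[OF refl], subst sum.swap, rule sum.cong[OF refl], rule sum.swap)
  also have "\<dots> = 0"
  proof (rule sum.neutral, rule ballI, rule sum.neutral, rule ballI, rule sum.neutral, rule ballI)
    fix k i j assume "k \<in> {..<n}" "i \<in> ?S" "j \<in> ?S"
    hence ij: "xs ! k \<in> set xs" "nat i < M" "nat j < M" "0 \<le> i" "0 \<le> j" by (auto simp: n_def)
    have "(a0 * xs ! k) mod p \<noteq> (b + int (nat i) + int (nat j)) mod p" using none ij by blast
    hence "\<not> p dvd a0 * xs ! k - (b + i + j)" using ij by (simp add: mod_eq_dvd_iff)
    thus "(\<Sum>t\<in>{0..<p}. e (t * (a0 * xs ! k - (b + i + j)))) = 0" by (simp add: sum_e)
  qed
  finally have "(\<Sum>t\<in>{0..<p}. H t) = 0" using n by simp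
  moreover have "{0..<p} = insert 0 {1..<p}" using p_pos by auto
  ultimately have "H 0 = - (\<Sum>t\<in>{1..<p}. H t)" by (simp add: eq_neg_iff_add_eq_0)
  moreover have "H 0 = of_nat M ^ 2"
    using n by (simp add: H_def expectation_def G_def n_def power2_eq_square)
  ultimately have "real M ^ 2 = norm (\<Sum>t\<in>{1..<p}. H t)" by (metis norm_minus_cancel norm_of_nat norm_power)
  also have "\<dots> \<le> (\<Sum>t\<in>{1..<p}. M / p * (norm (G t))\<^sup>2)"
  proof (rule sum_norm_le)
    fix t assume t: "t \<in> {1..<p}"
    hence "\<not> p dvd t" using zdvd_not_zless by auto
    hence "\<not> p dvd t * a0" using a0 prime by (simp add: prime_dvd_mult_iff)
    hence "norm (expectation xs (t * a0)) * (norm (G t))\<^sup>2 \<le> M / p * (norm (G t))\<^sup>2"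
      using small by (intro mult_right_mono) auto
    thus "norm (H t) \<le> M / p * (norm (G t))\<^sup>2"
      by (simp add: H_def norm_mult power2_eq_square)
  qed
  \<comment> \<open>Removing the frequency 0 from the Parseval sum saves M^3 / p; this makes the
    final inequality strict although \<open>small\<close> is not.\<close>
  also have "\<dots> = M / p * ((\<Sum>t\<in>{0..<p}. (norm (G t))\<^sup>2) - (norm (G 0))\<^sup>2)"
    using \<open>{0..<p} = _\<close> by (simp add: sum_distrib_left)
  also have "\<dots> = M / p * (p * real M - real M ^ 2)"
  proof -
    have "?S \<subseteq> {0..<p}" using M by auto
    from parseval[OF this] show ?thesis by (simp add: G_def)
  qed
  also have "\<dots> = real M ^ 2 - real M ^ 3 / p"
    using p_pos by (simp add: field_simps power2_eq_square power3_eq_cube)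
  finally have "real M ^ 3 / p \<le> 0" by simp
  moreover have "0 < real M ^ 3 / p" using M p_pos by simp
  ultimately show False by linarith
qed

end

section \<open>Hilbert cubes\<close>

text \<open>Disjointness of the blocks ensures that no index is used twice, so every exponent of a
  generator is 0 or 1.\<close>

lemma products_eq_prod_subset:
  assumes "x \<in> set (products (map (map a) Is))" "distinct (concat Is)"
  shows "\<exists>S \<subseteq> set (concat Is). x = prod a S"
  using assms
proof (induction Is arbitrary: x)
  case Nil
  thus ?case by (intro exI[of _ "{}"]) simp
next
  case (Cons I Is)
  then obtain i y where i: "i \<in> set I" "x = a i * y" and y: "y \<in> set (products (map (map a) Is))"
    by (auto simp: products.simps(2))
  obtain S where S: "S \<subseteq> set (concat Is)" "y = prod a S" using Cons.IH[OF y] Cons.prems(2) by auto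
  have "finite S" "i \<notin> S" using S(1) i(1) Cons.prems(2) finite_subset by auto
  hence "x = prod a (insert i S)" using i S by simp
  thus ?case using S(1) i(1) by (intro exI[of _ "insert i S"]) auto
qed

lemma concat_consecutive_blocks:
  "concat (map (\<lambda>i. [i * m + 1..<Suc i * m + 1]) [0..<n]) = [1..<n * m + 1]"
proof (induction n)
  case (Suc n)
  have "[1..<Suc n * m + 1] = [1..<n * m + 1] @ [n * m + 1..<Suc n * m + 1]"
    using upt_add_eq_append[of 1 "n * m + 1" m] by (simp add: algebra_simps)
  thus ?case using Suc by simp
qed simp

section \<open>Cubes and intervals in the residue ring, expressed through integers\<close>

context residues_prime
begin

lemma add_pow_one_eq: "add_pow R (j :: nat) \<one> = int j mod int p"
proof (induction j)
  case 0
  thus ?case by (simp add: res_zero_eq)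
next
  case (Suc j)
  thus ?case by (simp add: res_add_eq res_one_eq mod_simps add.commute)
qed

lemma interval_mem:
  assumes "is_interval R l I"
  obtains b where "\<And>i. i < l \<Longrightarrow> (b + int i) mod int p \<in> I"
  using assms unfolding is_interval_def
  by (force simp: add_pow_one_eq res_add_eq mod_simps)

lemma mult_hilbert_cube_mem:
  assumes "\<And>i. i \<in> {1..d} \<Longrightarrow> a i \<in> carrier R" "S \<subseteq> {1..d}"
  shows "(a0 * prod a S) mod int p \<in> mult_hilbert_cube R d a0 a"
proof -
  define n where "n i = (of_bool (i \<in> S) :: nat)" for i
  have "(\<Otimes>i\<in>{1..d}. a i [^] n i) = (\<Otimes>i\<in>{1..d}. (a i ^ n i) mod int p)"
  proof (rule finprod_cong')
    fix i assume "i \<in> {1..d}"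
    hence "a i mod int p = a i" using assms(1)[of i] by (simp add: res_carrier_eq)
    thus "a i [^] n i = (a i ^ n i) mod int p" using pow_cong[of "a i" "n i"] by simp
  qed auto
  also have "\<dots> = (\<Prod>i\<in>{1..d}. a i ^ n i) mod int p" by (rule prod_cong) simp
  also have "(\<Prod>i\<in>{1..d}. a i ^ n i) = prod a S"
    using assms(2) by (intro prod.mono_neutral_cong_right) (auto simp: n_def)
  finally have "a0 \<otimes> (\<Otimes>i\<in>{1..d}. a i [^] n i) = (a0 * prod a S) mod int p"
    by (simp add: res_mult_eq mod_simps)
  moreover have "\<forall>i\<in>{1..d}. n i \<in> {0, 1}" by (simp add: n_def)
  ultimately show ?thesis unfolding mult_hilbert_cube_def mem_Collect_eq by (intro exI[of _ n]) simp
qed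

text \<open>Splitting the first \<open>(k + 1) m\<close> generators into \<open>k + 1\<close> blocks embeds a product set of
  \<open>k + 1\<close> sets of size \<open>m\<close> into the cube.\<close>

lemma cube_meets_interval:
  fixes K L :: real and T U :: nat
  assumes L: "6 \<le> L" and T: "1 \<le> T" "T \<le> U" "L ^ (104 * 438 ^ j + 3) < T"
    and U: "L ^ (104 * 438 ^ j + 3) * U < real p"
    and m: "L * real p \<le> real m * U" "real p < (real m / L ^ 10) ^ (2 ^ j)" "2 * K * T \<le> m"
    and K: "1 \<le> K" "(8 * K) ^ (2 ^ k) \<le> L" and k: "0 < k" "real p \<le> L ^ (k - 1)" "Suc k * m \<le> d"
    and M: "1 \<le> M" "M \<le> p" "2 * M \<le> l + 1" "real p \<le> K * M"
    and I: "is_interval R l I" and H: "is_mult_hilbert_cube R d H"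
  shows "H \<inter> I \<noteq> {}"
proof -
  interpret prime_modulus "int p" by unfold_locales (use p_prime in simp)
  obtain a0 a where a0: "a0 \<in> Units R" and a: "\<And>i. i \<in> {1..d} \<Longrightarrow> a i \<in> Units R" "inj_on a {1..d}"
    and Heq: "H = mult_hilbert_cube R d a0 a"
    using H unfolding is_mult_hilbert_cube_def by blast
  obtain b where b: "\<And>i. i < l \<Longrightarrow> (b + int i) mod int p \<in> I" using interval_mem[OF I] by blast
  define B where "B i = [i * m + 1..<Suc i * m + 1]" for i
  define Is where "Is = map B [0..<Suc k]"
  have cc: "concat Is = [1..<Suc k * m + 1]"
    unfolding Is_def B_def by (rule concat_consecutive_blocks)
  have Bd: "set (B i) \<subseteq> {1..d}" if "i < Suc k" for i
  proof -
    have "Suc i * m \<le> Suc k * m" using that by (intro mult_le_mono1) auto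
    hence "Suc i * m \<le> d" using k(3) by linarith
    moreover have "1 \<le> x \<and> x \<le> Suc i * m" if "x \<in> set (B i)" for x
      using that unfolding B_def by (auto simp del: mult_Suc) simp
    ultimately show ?thesis by force
  qed
  define f where "f i = map a (B i)" for i
  have ff: "distinct (f i) \<and> set (f i) \<subseteq> {1..<int p} \<and> length (f i) = m" if "i < Suc k" for i
  proof -
    have "inj_on a (set (B i))" using a(2) Bd[OF that] inj_on_subset by blast
    moreover have "a n \<in> {1..<int p}" if "n \<in> set (B i)" for n
      using a(1)[of n] Bd[OF \<open>i < Suc k\<close>] that prime_gt_0_nat[OF p_prime]
      by (auto simp: res_prime_units_eq)
    ultimately show ?thesis by (auto simp: f_def distinct_map B_def)
  qed
  define ass where "ass = map f [1..<Suc k]"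
  have fa: "map (map a) Is = f 0 # ass"
    unfolding Is_def ass_def f_def by (subst upt_conv_Cons) simp_all
  have len: "length ass = k" by (simp add: ass_def)
  have "norm (expectation (products (f 0 # ass)) t) \<le> M / real_of_int (int p)" if "\<not> int p dvd t" for t
  proof -
    have "norm (expectation (products (f 0 # ass)) t) < 1 / K"
    proof (rule norm_expectation_products_less[OF L T])
      show "L ^ (104 * 438 ^ j + 3) * real U < real_of_int (int p)" using U by simp
      show "distinct as \<and> set as \<subseteq> {1..<int p} \<and> L * real_of_int (int p) \<le> real (length as * U) \<and>
          real_of_int (int p) < (real (length as) / L ^ 10) ^ 2 ^ j" if as: "as \<in> set ass" for as
      proof -
        obtain i where i: "as = f i" "i < Suc k" using as by (auto simp: ass_def)
        show ?thesis using ff[OF i(2)] m unfolding i(1) by simp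
      qed
    qed (use ff[of 0] m K k len that in auto)
    also have "\<dots> \<le> M / real p"
      using M(1,2,4) K(1) by (simp add: field_simps)
    finally show ?thesis by simp
  qed
  moreover have "products (f 0 # ass) \<noteq> []"
  proof (rule products_nonempty)
    fix as assume "as \<in> set (f 0 # ass)"
    hence "\<exists>i<Suc k. as = f i" unfolding ass_def by (auto intro: less_SucI)
    moreover have "0 < 2 * K * T" using K(1) T(1) by simp
    hence "m \<noteq> 0" using m(3) by linarith
    ultimately show "as \<noteq> []" using ff by fastforce
  qed
  moreover have "\<not> int p dvd a0" using a0 zdvd_not_zless by (auto simp: res_prime_units_eq)
  ultimately have "\<exists>x\<in>set (products (f 0 # ass)). \<exists>i<M. \<exists>i'<M.
      (a0 * x) mod int p = (b + int i + int i') mod int p"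
    using M(1,2) by (intro interval_hit) auto
  then obtain x i i' where x: "x \<in> set (products (f 0 # ass))" "i < M" "i' < M"
    "(a0 * x) mod int p = (b + int i + int i') mod int p"
    by blast
  have "x \<in> set (products (map (map a) Is))" using x(1) unfolding fa .
  moreover have "distinct (concat Is)" unfolding cc by (rule distinct_upt)
  ultimately obtain S where S: "S \<subseteq> set (concat Is)" "x = prod a S"
    using products_eq_prod_subset by blast
  have "S \<subseteq> {1..d}" using S(1) k(3) unfolding cc by auto
  hence "(a0 * x) mod int p \<in> H"
    unfolding Heq S(2) by (intro mult_hilbert_cube_mem Units_closed a(1))
  \<comment> \<open>Both indices are at most M - 1, so their sum is at most 2M - 2 < l.\<close>
  moreover have "(b + int (i + i')) mod int p \<in> I" using x(2,3) M(3) by (intro b) simp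
  ultimately show ?thesis using x(4) by (auto simp: add.assoc)
qed

text \<open>Distinct generators give this trivial bound, which settles the primes too small for the
  asymptotic choice of parameters.\<close>

lemma cube_dimension_le:
  assumes "is_mult_hilbert_cube R d H"
  shows "d \<le> p"
proof -
  obtain a where a: "\<And>i. i \<in> {1..d} \<Longrightarrow> a i \<in> Units R" "inj_on a {1..d}"
    using assms unfolding is_mult_hilbert_cube_def by blast
  have "card {1..d} \<le> card (Units R)" using a by (intro card_inj_on_le) auto
  also have "\<dots> \<le> p" by (simp add: res_prime_units_eq)
  finally show ?thesis by simp
qed

end

text \<open>All parameters are powers of p up to rounding: T is about p^(\<epsilon>/4), U about p^(1
  - \<epsilon>/4), and a block has m about p^(\<epsilon>/2) elements. The hypotheses of
  \<open>cube_meets_interval\<close> become inequalities between exponents, with constants absorbed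
  by a spare p^\<delta>.\<close>

lemma cube_bound_lt_1:
  fixes \<epsilon> :: real
  assumes \<epsilon>: "0 < \<epsilon>" "\<epsilon> < 1"
  shows "\<exists>\<delta>>0. \<exists>C>0. \<forall>p :: nat. prime p \<longrightarrow>
    (\<forall>I H d. is_interval (Fp p) (interval_length p \<delta>) I \<longrightarrow> is_mult_hilbert_cube (Fp p) d H \<longrightarrow>
      H \<inter> I = {} \<longrightarrow> real d \<le> C * real p powr \<epsilon>)"
proof -
  \<comment> \<open>A block satisfies m / L^10 \<ge> p^(\<epsilon>/4), so its power 2^j exceeds
    p.\<close>
  obtain j :: nat where "4 / \<epsilon> < 2 ^ j" using real_arch_pow[of 2 "4 / \<epsilon>"] by auto
  hence j: "1 < \<epsilon> / 4 * 2 ^ j" using \<epsilon> by (simp add: field_simps)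
  define E :: nat where "E = 104 * 438 ^ j + 3"
  have "(1::nat) \<le> 438 ^ j" by simp
  hence "10 \<le> E" unfolding E_def by linarith
  hence E: "real E \<ge> 10" by simp
  \<comment> \<open>This makes L^E equal to p^(\<epsilon>/8), which lies below T and leaves room
    between U and p; as E \<ge> 10, also L^10 \<le> p^(\<epsilon>/8).\<close>
  define lam where "lam = \<epsilon> / (8 * E)"
  have lam: "0 < lam" "lam * E = \<epsilon> / 8" "10 * lam \<le> \<epsilon> / 8"
    using \<epsilon> E by (auto simp: lam_def field_simps)
  \<comment> \<open>Chosen so that L^k0 \<ge> p; \<open>k\<close> is one larger because the last
    block is handled by Parseval without growth.\<close>
  obtain k0 :: nat where "1 / lam < k0" using reals_Archimedean2 by blast
  hence k0: "1 \<le> lam * k0" using lam by (simp add: field_simps)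
  define k where "k = Suc k0"
  \<comment> \<open>With K = p^(2 \<delta>) this gives K^(2^k) = p^(lam/2), leaving another
    p^(lam/2) of L for the constant 8^(2^k).\<close>
  define \<delta> where "\<delta> = lam / 2 ^ (k + 2)"
  have \<delta>: "0 < \<delta>" "2 * \<delta> * 2 ^ k = lam / 2" using lam by (simp_all add: \<delta>_def)
  have \<delta>lam: "4 * \<delta> \<le> lam"
  proof -
    have "lam / 2 ^ (k + 2) \<le> lam / 2 ^ 2" using lam by (intro divide_left_mono power_increasing) auto
    thus ?thesis by (simp add: \<delta>_def)
  qed
  \<comment> \<open>A common bound for every constant that p^\<delta> has to absorb.\<close>
  define c :: real where "c = 8 ^ (2 ^ k) + 4 * real (Suc k) + 8"
  have c: "8 ^ (2 ^ k) \<le> c" "4 * real (Suc k) \<le> c" "8 \<le> c" by (simp_all add: c_def)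
  define C where "C = max 1 (c powr (1 / \<delta>))"
  have "real d \<le> C * real p powr \<epsilon>"
    if p: "prime p" and I: "is_interval (Fp p) (interval_length p \<delta>) I"
      and H: "is_mult_hilbert_cube (Fp p) d H" and disj: "H \<inter> I = {}" for p I H d
  proof (rule ccontr)
    assume neg: "\<not> ?thesis"
    interpret residues_prime p "Fp p" by unfold_locales fact
    have P1: "1 < real p" using prime_gt_1_nat[OF p] by simp
    define P where "P = real p"
    have P: "1 < P" using P1 by (simp add: P_def)
    have mono: "P powr x \<le> P powr y" if "x \<le> y" for x y using P that by simp
    have ge1: "1 \<le> P powr x" if "0 \<le> x" for x using mono[OF that] P by simp
    have d_gt: "C * P powr \<epsilon> < d" using neg by (simp add: P_def)
    \<comment> \<open>If p^\<delta> < c then p < C, and the trivial bound d \<le> p contradicts the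
      assumed size of d.\<close>
    have large: "c \<le> P powr \<delta>"
    proof (rule ccontr)
      assume "\<not> ?thesis"
      hence "(P powr \<delta>) powr (1 / \<delta>) < c powr (1 / \<delta>)" using \<delta> P by (intro powr_less_mono2) auto
      hence "P < C" using \<delta> P by (simp add: powr_powr C_def)
      moreover have "C * 1 \<le> C * P powr \<epsilon>" using ge1[of \<epsilon>] \<epsilon> by (intro mult_left_mono) (auto simp: C_def)
      ultimately show False using d_gt cube_dimension_le[OF H] by (simp add: P_def)
    qed
    have big: "c \<le> P powr x" if "\<delta> \<le> x" for x using mono[OF that] large by linarith
    have d_gt': "P powr \<epsilon> < d"
    proof -
      have "1 * P powr \<epsilon> \<le> C * P powr \<epsilon>" by (intro mult_right_mono) (auto simp: C_def)
      thus ?thesis using d_gt by linarith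
    qed
    \<comment> \<open>One factor p^\<delta> of \<open>K\<close> accounts for the length p^(1 -
      \<delta>) of the interval, the other for rounding and halving that length.\<close>
    define L K where "L = P powr lam" and "K = P powr (2 * \<delta>)"
    define T U m where "T = nat \<lceil>P powr (\<epsilon> / 4)\<rceil>" and "U = nat \<lfloor>P powr (1 - \<epsilon> / 4)\<rfloor>"
      and "m = nat \<lceil>P powr (\<epsilon> / 2)\<rceil>"
    have Lpow: "L ^ n = P powr (lam * n)" for n
      using P by (simp add: L_def powr_powr flip: powr_realpow)
    have LE: "L ^ E = P powr (\<epsilon> / 8)" unfolding Lpow lam(2) ..
    have ceil: "x \<le> real (nat \<lceil>x\<rceil>)" "real (nat \<lceil>x\<rceil>) \<le> 2 * x" if "1 \<le> x" for x
      using that by linarith+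
    have floor: "real (nat \<lfloor>x\<rfloor>) \<le> x" "x \<le> 2 * real (nat \<lfloor>x\<rfloor>)" if "1 \<le> x" for x
    proof -
      have "1 \<le> \<lfloor>x\<rfloor>" using that by simp
      hence "real (nat \<lfloor>x\<rfloor>) = of_int \<lfloor>x\<rfloor>" "1 \<le> real_of_int \<lfloor>x\<rfloor>" by simp_all
      thus "real (nat \<lfloor>x\<rfloor>) \<le> x" "x \<le> 2 * real (nat \<lfloor>x\<rfloor>)" by linarith+
    qed
    have T: "P powr (\<epsilon> / 4) \<le> T" "T \<le> 2 * P powr (\<epsilon> / 4)"
      unfolding T_def using \<epsilon> by (intro ceil ge1; simp)+
    have U: "U \<le> P powr (1 - \<epsilon> / 4)" "P powr (1 - \<epsilon> / 4) \<le> 2 * real U"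
      unfolding U_def using \<epsilon> by (intro floor ge1; simp)+
    have m: "P powr (\<epsilon> / 2) \<le> m" "m \<le> 2 * P powr (\<epsilon> / 2)"
      unfolding m_def using \<epsilon> by (intro ceil ge1; simp)+
    define l where "l = interval_length p \<delta>"
    have l: "l \<le> P powr (1 - \<delta>)" "P powr (1 - \<delta>) \<le> 2 * real l"
      unfolding l_def interval_length_def P_def[symmetric] using \<epsilon> \<delta>lam lam E
      by (intro floor ge1; simp)+
    define M where "M = (l + 1) div 2"
    have M: "2 * M \<le> l + 1" "l \<le> 2 * M" by (auto simp: M_def)
    have mult_powr: "P powr x * P powr y = P powr (x + y)" for x y by (simp add: powr_add)
    have "H \<inter> I \<noteq> {}"
    proof (rule cube_meets_interval[OF _ _ _ _ _ _ _ _ _ _ _ _ _ _ _ _ _ I[folded l_def] H])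
      show "6 \<le> L" using big[of lam] c \<delta>lam \<delta>(1) by (simp add: L_def)
      show "1 \<le> T" using T(1) ge1[of "\<epsilon> / 4"] \<epsilon> by simp
      show "L ^ (104 * 438 ^ j + 3) < T"
      proof -
        have "P powr (\<epsilon> / 8) < P powr (\<epsilon> / 4)" using P \<epsilon> by simp
        thus ?thesis using T(1) LE unfolding E_def by linarith
      qed
      show "L ^ (104 * 438 ^ j + 3) * U < real p"
      proof -
        have "L ^ E * U \<le> P powr (\<epsilon> / 8) * P powr (1 - \<epsilon> / 4)"
          unfolding LE using U by (intro mult_left_mono) auto
        also have "\<dots> < P powr 1"
          unfolding mult_powr by (rule powr_less_mono) (use P \<epsilon> in auto)
        finally show ?thesis using P by (simp add: E_def P_def)
      qed
      show "T \<le> U"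
      proof -
        have "8 * P powr (\<epsilon> / 4) \<le> P powr (1 - \<epsilon> / 2) * P powr (\<epsilon> / 4)"
          using big[of "1 - \<epsilon> / 2"] c \<epsilon> \<delta>lam lam by (intro mult_right_mono) auto
        also have "\<dots> = P powr (1 - \<epsilon> / 4)" by (simp add: mult_powr)
        finally have "real T \<le> U" using T(2) U(2) ge1[of "\<epsilon> / 4"] \<epsilon> by linarith
        thus ?thesis by simp
      qed
      show "L * real p \<le> real m * U"
      proof -
        have "2 * L * P \<le> P powr (\<epsilon> / 4 - lam) * L * P"
          using big[of "\<epsilon> / 4 - lam"] c \<delta>lam lam P by (intro mult_right_mono) (auto simp: L_def)
        also have "\<dots> = P powr (\<epsilon> / 4 - lam) * P powr lam * P powr 1" using P by (simp add: L_def)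
        also have "\<dots> = P powr (\<epsilon> / 2) * P powr (1 - \<epsilon> / 4)"
          unfolding mult_powr by (rule arg_cong) simp
        also have "\<dots> \<le> real m * (2 * real U)" using m U by (intro mult_mono) auto
        finally show ?thesis by (simp add: P_def)
      qed
      show "real p < (real m / L ^ 10) ^ (2 ^ j)"
      proof -
        have "P powr (\<epsilon> / 4) \<le> P powr (\<epsilon> / 2 - lam * 10)" using lam \<epsilon> by (intro mono) simp
        also have "\<dots> = P powr (\<epsilon> / 2) / L ^ 10" unfolding Lpow by (simp add: powr_diff)
        also have "\<dots> \<le> m / L ^ 10" using m(1) by (intro divide_right_mono) (auto simp: L_def)
        finally have "(P powr (\<epsilon> / 4)) ^ (2 ^ j) \<le> (m / L ^ 10) ^ (2 ^ j)" by (intro power_mono) auto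
        moreover have "P powr 1 < P powr (\<epsilon> / 4 * 2 ^ j)" using P j by (intro powr_less_mono) auto
        moreover have "(P powr (\<epsilon> / 4)) ^ (2 ^ j) = P powr (\<epsilon> / 4 * 2 ^ j)"
          using P by (simp add: powr_powr flip: powr_realpow)
        moreover have "P powr 1 = real p" using P by (simp add: P_def)
        ultimately show ?thesis by linarith
      qed
      show "2 * K * T \<le> m"
      proof -
        have "2 * K * T \<le> 2 * K * (2 * P powr (\<epsilon> / 4))" using T(2) by (intro mult_left_mono) (auto simp: K_def)
        also have "\<dots> = 4 * P powr (2 * \<delta> + \<epsilon> / 4)" by (simp add: K_def mult_powr)
        also have "\<dots> \<le> P powr (\<epsilon> / 4 - 2 * \<delta>) * P powr (2 * \<delta> + \<epsilon> / 4)"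
          using big[of "\<epsilon> / 4 - 2 * \<delta>"] c \<delta>lam lam \<delta>(1) by (intro mult_right_mono) auto
        also have "\<dots> = P powr (\<epsilon> / 2)" by (simp add: mult_powr)
        finally show ?thesis using m(1) by linarith
      qed
      show K1: "1 \<le> K" using ge1[of "2 * \<delta>"] \<delta> by (simp add: K_def)
      show "(8 * K) ^ (2 ^ k) \<le> L"
      proof -
        have "K ^ (2 ^ k) = P powr (lam / 2)"
        proof -
          have ex: "real (2 ^ k) * (2 * \<delta>) = lam / 2" using \<delta>(2) by (simp add: mult.commute)
          have "P \<noteq> 0" using P by simp
          thus ?thesis unfolding K_def by (simp only: powr_power ex not_False_eq_True)
        qed
        hence "(8 * K) ^ (2 ^ k) = 8 ^ (2 ^ k) * P powr (lam / 2)" by (simp add: power_mult_distrib)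
        also have "\<dots> \<le> P powr (lam / 2) * P powr (lam / 2)"
          using big[of "lam / 2"] c(1) \<delta>lam \<delta>(1) by (intro mult_right_mono) auto
        also have "\<dots> = L" by (simp add: mult_powr L_def)
        finally show ?thesis .
      qed
      show "0 < k" by (simp add: k_def)
      show "real p \<le> L ^ (k - 1)"
        using mono[OF k0] P unfolding Lpow k_def by (simp add: P_def)
      show "Suc k * m \<le> d"
      proof -
        have "real (Suc k * m) \<le> Suc k * (2 * P powr (\<epsilon> / 2))"
          unfolding of_nat_mult using m(2) by (intro mult_left_mono) auto
        also have "\<dots> \<le> P powr (\<epsilon> / 2) * P powr (\<epsilon> / 2)"
        proof -
          have "2 * real (Suc k) \<le> P powr (\<epsilon> / 2)"
            using big[of "\<epsilon> / 2"] c(2) \<delta>lam lam by (simp del: of_nat_Suc)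
          hence "2 * real (Suc k) * P powr (\<epsilon> / 2) \<le> P powr (\<epsilon> / 2) * P powr (\<epsilon> / 2)"
            by (intro mult_right_mono) auto
          thus ?thesis by (simp only: mult_ac)
        qed
        also have "\<dots> = P powr \<epsilon>" by (simp add: mult_powr)
        finally show ?thesis using d_gt' by linarith
      qed
      have l1: "1 \<le> l" using l(2) ge1[of "1 - \<delta>"] \<delta>lam lam \<epsilon> by linarith
      thus "1 \<le> M" by (simp add: M_def)
      have "P powr (1 - \<delta>) \<le> P powr 1" using \<delta> by (intro mono) simp
      hence "real l \<le> real p" using l(1) P by (simp add: P_def)
      thus "M \<le> p" using l1 by (simp add: M_def)
      show "2 * M \<le> l + 1" by (rule M)
      show "real p \<le> K * M"
      proof -
        have "4 * P powr 1 \<le> P powr \<delta> * P powr 1" using large c by (intro mult_right_mono) auto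
        also have "\<dots> = K * P powr (1 - \<delta>)"
          unfolding K_def mult_powr by (rule arg_cong) simp
        also have "\<dots> \<le> K * (4 * real M)" using l(2) M(2) K1 by (intro mult_left_mono) auto
        finally show ?thesis using P by (simp add: P_def)
      qed
    qed
    thus False using disj by blast
  qed
  moreover have "C > 0" by (simp add: C_def)
  ultimately show ?thesis using \<delta>(1) by blast
qed

theorem theorem1p5:
  fixes \<epsilon> :: real
  assumes "\<epsilon> > 0"
  shows "\<exists>\<delta>>0. \<exists>C>0. \<forall>p :: nat. prime p \<longrightarrow>
           (\<forall>(I :: int set) (H :: int set) (d :: nat).
              is_interval (Fp p) (interval_length p \<delta>) I \<longrightarrow>
              is_mult_hilbert_cube (Fp p) d H \<longrightarrow>
              H \<inter> I = {} \<longrightarrow>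
              real d \<le> C * real p powr \<epsilon>)"
proof -
  \<comment> \<open>Since p \<ge> 1, a bound with a smaller exponent implies the one with
    \<epsilon>, so large \<epsilon> can be cut down to 1/2.\<close>
  define \<epsilon>' where "\<epsilon>' = min \<epsilon> (1 / 2)"
  have "0 < \<epsilon>'" "\<epsilon>' < 1" using assms by (auto simp: \<epsilon>'_def)
  from cube_bound_lt_1[OF this] obtain \<delta> C where \<delta>C: "\<delta> > 0" "C > 0" and bound: "\<forall>p :: nat. prime p \<longrightarrow>
      (\<forall>I H d. is_interval (Fp p) (interval_length p \<delta>) I \<longrightarrow> is_mult_hilbert_cube (Fp p) d H \<longrightarrow>
        H \<inter> I = {} \<longrightarrow> real d \<le> C * real p powr \<epsilon>')" by blast
  have "C * real p powr \<epsilon>' \<le> C * real p powr \<epsilon>" if "prime p" for p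
    using prime_ge_1_nat[OF that] \<delta>C by (intro mult_left_mono powr_mono) (auto simp: \<epsilon>'_def)
  thus ?thesis using bound \<delta>C by (meson order_trans)
qed

end
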